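(* Let $n\ge2$, let $c\ge1$, and let $D$ be an unbounded $c$-John domain in $\mathbb{R}^n$ with $D\ne\mathbb{R}^n$. Let $\delta\in(0,1)$ and $1\le p,q<\infty$ be such that $p<n/\delta$ and $0\le 1/p-1/q\le\delta/n$. Then the following conditions are equivalent. (A) A fractional $(\delta,q,p)$-Hardy inequality holds in $D$, i.e. there is a constant $C>0$ such that $$\int_{D}\frac{|u(x)|^q}{\mathrm{dist}(x,\partial D)^{q(\delta+n(1/q-1/p))}}\,dx\le C\Big(\int_D\int_D\frac{|u(x)-u(y)|^p}{|x-y|^{n+\delta p}}\,dy\,dx\Big)^{q/p}$$ for all $u\in C_0(D)$. (B) There exists a constant $N>0$ such that $$\Big(\sum_{Q\in\mathcal{W}(D)}\mathrm{cap}_{\delta,p}(K\cap Q,D)^{q/p}\Big)^{p/q}\le N\,\mathrm{cap}_{\delta,p}(K,D)$$ for every compact set $K$ in $D$.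
   Context: A domain $D$ in $\mathbb{R}^n$ with $n\ge2$ is a $c$-John domain, $c\ge1$, if each pair of points $x_1,x_2\in D$ can be joined by a rectifiable curve $\gamma:[0,\ell]\to D$ parametrized by its arc length (so $\gamma(0)=x_1$, $\gamma(\ell)=x_2$) such that $\mathrm{dist}(\gamma(t),\partial D)\ge\min\{t,\ell-t\}/c$ for every $t\in[0,\ell]$. For an open set $G\subset\mathbb{R}^n$, $C_0(G)$ is the family of all continuous functions $u:G\to\mathbb{R}$ with compact support in $G$. For a compact set $K\subset G$, the $(\delta,p)$-capacity is $$\mathrm{cap}_{\delta,p}(K,G)=\inf_u\int_G\int_G\frac{|u(x)-u(y)|^p}{|x-y|^{n+\delta p}}\,dy\,dx,$$ where the infimum is taken over all $u\in C_0(G)$ such that $u(x)\ge1$ for each $x\in K$. For a proper open set $G\subset\mathbb{R}^n$, $\mathcal{W}(G)$ is a fixed Whitney decomposition of $G$, that is, a family of closed dyadic cubes with pairwise disjoint interiors whose union is $G$, such that $\mathrm{diam}(Q)\le\mathrm{dist}(Q,\partial G)\le4\,\mathrm{diam}(Q)$ for each $Q\in\mathcal{W}(G)$, and such that the concentrically dilated cubes $\tfrac98Q$, $Q\in\mathcal{W}(G)$, are contained in $G$ and have overlap bounded by a constant depending only on $n$. *)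

theory Defs
  imports "HOL-Analysis.Analysis"
begin

text \<open>The space \<open>\<real>\<^sup>n\<close> is \<^typ>\<open>real ^ 'n\<close>, with \<open>n = CARD('n)\<close>.  Integrals and capacities take
  values in \<^typ>\<open>ennreal\<close>, since the energies of functions that are only continuous may be
  infinite.\<close>

text \<open>Real powers of extended nonnegative reals; only used for exponents \<open>r > 0\<close>.\<close>

definition ennpowr :: "ennreal \<Rightarrow> real \<Rightarrow> ennreal" where
  "ennpowr a r = (if a = top then top else ennreal (enn2real a powr r))"


subsection \<open>John domains\<close>

definition curve_length :: "(real \<Rightarrow> 'a::metric_space) \<Rightarrow> real \<Rightarrow> real \<Rightarrow> ennreal" where
  "curve_length \<gamma> a b =
     (SUP (m, t) \<in> {(m :: nat, t :: nat \<Rightarrow> real). mono_on {..m} t \<and> t ` {..m} \<subseteq> {a..b}}.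
        ennreal (\<Sum>i<m. dist (\<gamma> (t i)) (\<gamma> (t (Suc i)))))"

text \<open>Rectifiability is implied, since \<open>curve_length \<gamma> 0 l = l\<close> is finite.\<close>

definition arc_length_parametrized :: "(real \<Rightarrow> 'a::metric_space) \<Rightarrow> real \<Rightarrow> bool" where
  "arc_length_parametrized \<gamma> l \<longleftrightarrow>
     0 \<le> l \<and> continuous_on {0..l} \<gamma> \<and> (\<forall>t\<in>{0..l}. curve_length \<gamma> 0 t = ennreal t)"

text \<open>For \<open>D = \<real>\<^sup>n\<close> the library's \<^const>\<open>infdist\<close> to the empty boundary is \<open>0\<close> rather than
  \<open>\<infinity>\<close>, so the definition is only meaningful for \<open>D \<noteq> \<real>\<^sup>n\<close>.\<close>

definition john_domain :: "real \<Rightarrow> (real ^ 'n) set \<Rightarrow> bool" where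
  "john_domain c D \<longleftrightarrow>
     open D \<and> connected D \<and> D \<noteq> {} \<and>
     (\<forall>x1\<in>D. \<forall>x2\<in>D. \<exists>\<gamma> l.
        arc_length_parametrized \<gamma> l \<and> \<gamma> ` {0..l} \<subseteq> D \<and> \<gamma> 0 = x1 \<and> \<gamma> l = x2 \<and>
        (\<forall>t\<in>{0..l}. infdist (\<gamma> t) (frontier D) \<ge> min t (l - t) / c))"


subsection \<open>Fractional capacity and Hardy inequality\<close>

text \<open>A function \<open>G \<rightarrow> \<real>\<close> is a total function whose values outside \<open>G\<close> are irrelevant.\<close>

definition C0 :: "(real ^ 'n) set \<Rightarrow> (real ^ 'n \<Rightarrow> real) set" where
  "C0 G = {u. continuous_on G u \<and>
              compact (closure {x\<in>G. u x \<noteq> 0}) \<and> closure {x\<in>G. u x \<noteq> 0} \<subseteq> G}"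

text \<open>On the null set \<open>x = y\<close> the integrand has the value \<open>0 / 0 = 0\<close>.\<close>

definition frac_energy ::
  "real \<Rightarrow> real \<Rightarrow> (real ^ 'n) set \<Rightarrow> (real ^ 'n \<Rightarrow> real) \<Rightarrow> ennreal" where
  "frac_energy \<delta> p G u =
     (\<integral>\<^sup>+x\<in>G. (\<integral>\<^sup>+y\<in>G. ennreal (\<bar>u x - u y\<bar> powr p / norm (x - y) powr (real CARD('n) + \<delta> * p))
        \<partial>lborel) \<partial>lborel)"

definition frac_cap :: "real \<Rightarrow> real \<Rightarrow> (real ^ 'n) set \<Rightarrow> (real ^ 'n) set \<Rightarrow> ennreal" where
  "frac_cap \<delta> p K G = (INF u \<in> {u \<in> C0 G. \<forall>x\<in>K. u x \<ge> 1}. frac_energy \<delta> p G u)"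

definition frac_hardy :: "real \<Rightarrow> real \<Rightarrow> real \<Rightarrow> (real ^ 'n) set \<Rightarrow> bool" where
  "frac_hardy \<delta> q p D \<longleftrightarrow>
     (\<exists>C::real. C > 0 \<and> (\<forall>u \<in> C0 D.
        (\<integral>\<^sup>+x\<in>D. ennreal (\<bar>u x\<bar> powr q /
             infdist x (frontier D) powr (q * (\<delta> + real CARD('n) * (1/q - 1/p)))) \<partial>lborel)
        \<le> ennreal C * ennpowr (frac_energy \<delta> p D u) (q / p)))"


subsection \<open>Whitney decompositions\<close>

text \<open>The side length is \<open>2\<^sup>k\<close> with \<open>k\<close> an arbitrary integer.\<close>

definition dyadic_cube :: "(real ^ 'n) set \<Rightarrow> bool" where
  "dyadic_cube Q \<longleftrightarrow> (\<exists>(k::int) (m :: int ^ 'n).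
     Q = cbox (\<chi> i. real_of_int (m $ i) * 2 powi k) (\<chi> i. (real_of_int (m $ i) + 1) * 2 powi k))"

definition dilate_cube :: "real \<Rightarrow> (real ^ 'n) set \<Rightarrow> (real ^ 'n) set" where
  "dilate_cube s Q =
     (let z = midpoint (interval_lowerbound Q) (interval_upperbound Q)
      in (\<lambda>x. z + s *\<^sub>R (x - z)) ` Q)"

text \<open>The overlap bound \<open>M\<close> is usually required to depend on the dimension only.  Here it may
  depend on \<open>G\<close> and \<open>W\<close>, which makes a statement about all Whitney decompositions of a
  set at least as general.\<close>

definition whitney_decomposition :: "(real ^ 'n) set \<Rightarrow> (real ^ 'n) set set \<Rightarrow> bool" where
  "whitney_decomposition G W \<longleftrightarrow>
     (\<forall>Q\<in>W. dyadic_cube Q) \<and>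
     pairwise (\<lambda>Q R. interior Q \<inter> interior R = {}) W \<and>
     \<Union>W = G \<and>
     (\<forall>Q\<in>W. diameter Q \<le> setdist Q (frontier G) \<and> setdist Q (frontier G) \<le> 4 * diameter Q) \<and>
     (\<forall>Q\<in>W. dilate_cube (9/8) Q \<subseteq> G) \<and>
     (\<exists>M::nat. \<forall>x. finite {Q\<in>W. x \<in> dilate_cube (9/8) Q} \<and>
                   card {Q\<in>W. x \<in> dilate_cube (9/8) Q} \<le> M)"

end

theory Submission
  imports Defs
begin

text \<open>
  Write \<open>n\<close> for the dimension, \<open>\<theta> = \<delta>p/n < 1\<close>, \<open>r = q/p \<ge> 1\<close>, \<open>E(u)\<close> for the fractional energy,
  and \<open>\<alpha> = q(\<delta> + n(1/q - 1/p)) = n(1 - r(1 - \<theta>)) \<ge> 0\<close> for the exponent of the weight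
  \<open>dist(x, \<partial>D)\<^sup>-\<^sup>\<alpha>\<close>.  On a Whitney cube of side length \<open>l\<close> the weight is comparable to \<open>l\<^sup>-\<^sup>\<alpha>\<close>.

  From Hardy to capacities: let \<open>u \<ge> 1\<close> on \<open>K\<close>, and multiply \<open>u\<close> by a Lipschitz cutoff that is
  \<open>1\<close> on a Whitney cube \<open>Q\<close> and supported in the dilated cube \<open>Q*\<close>.  The product competes for
  the capacity of \<open>K \<inter> Q\<close>, and its energy is at most a constant times the part of \<open>E(u)\<close> with
  one variable in \<open>Q*\<close> plus \<open>l\<^sup>-\<^sup>\<delta>\<^sup>p\<close> times the integral of \<open>\<bar>u\<bar>\<^sup>p\<close> over \<open>Q*\<close>
  (\<open>cutoff_energy_le\<close>).  By Hoelder's inequality, the \<open>r\<close>-th power of the second term is at most a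
  constant times the weighted integral of \<open>\<bar>u\<bar>\<^sup>q\<close> over \<open>Q*\<close> (\<open>whitney_cube_capacity_le\<close>).  Since
  the cubes \<open>Q*\<close> have bounded overlap and \<open>r \<ge> 1\<close>, summation over \<open>Q\<close> leaves \<open>E(u)\<^sup>r\<close> and the
  left-hand side of the Hardy inequality (\<open>capacity_sum_from_hardy\<close>).

  From capacities to Hardy: this is Maz'ya's truncation argument.  Cut \<open>\<bar>u\<bar>\<close> into the layers
  between consecutive powers of \<open>2\<close>.  The layer below height \<open>2\<^sup>k\<close>, rescaled, competes for the
  capacity of \<open>A\<^sub>k = {\<bar>u\<bar> \<ge> 2\<^sup>k}\<close>, and the energies of all layers add up to at most \<open>E(u)\<close>
  because the differences of the layers add up to the difference of \<open>\<bar>u\<bar>\<close> and \<open>t \<mapsto> t\<^sup>p\<close> is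
  superadditive (\<open>sum_layer_energy_le\<close>).  The weighted measure of \<open>A\<^sub>k\<close> is at most the sum over \<open>Q\<close> of
  that of \<open>A\<^sub>k \<inter> Q\<close>, and the latter is at most a constant times the \<open>r\<close>-th power of the capacity of
  \<open>A\<^sub>k \<inter> Q\<close> (\<open>whitney_cube_weight_le_capacity\<close>).  So the capacity condition bounds it by
  the \<open>r\<close>-th power of the capacity of \<open>A\<^sub>k\<close>, and it remains to sum over \<open>k\<close>, again with \<open>r \<ge> 1\<close>
  (\<open>weighted_inequality_from_capacity\<close>).

  The estimate on a single cube rests on the isocapacitary inequality
  \<open>\<bar>K\<bar>\<^sup>1\<^sup>-\<^sup>\<theta> \<le> C cap(K, D)\<close>, a weak form of the fractional Sobolev inequality
  (\<open>weak_fractional_sobolev\<close>).  This is where the domain matters: the John curves from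
  \<open>x \<in> D\<close> to far away points show that \<open>D \<inter> B(x, r)\<close> has measure at least \<open>\<kappa>r\<^sup>n\<close> at every scale
  \<open>r > 0\<close> (\<open>john_domain_measure_density\<close>).  Hence a set \<open>B\<close> of finite measure \<open>b\<close> leaves room for
  \<open>D - B\<close> within distance about \<open>b\<^sup>1\<^sup>/\<^sup>n\<close> of any point of \<open>D\<close>, and the interaction between a superlevel
  set of \<open>v\<close> and the complement of the next lower one bounds the energy from below.
\<close>

section \<open>Powers and sums of extended nonnegative reals\<close>

lemma ennpowr_ennreal: "0 \<le> x \<Longrightarrow> ennpowr (ennreal x) r = ennreal (x powr r)"
  by (simp add: ennpowr_def)

lemma ennpowr_top [simp]: "ennpowr top r = top"
  by (simp add: ennpowr_def)

lemma ennpowr_0 [simp]: "ennpowr 0 r = 0"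
  by (simp add: ennpowr_def)

lemma ennpowr_mono:
  assumes "a \<le> b" "0 < r"
  shows "ennpowr a r \<le> ennpowr b r"
proof (cases "b = top")
  case False
  then show ?thesis
    using assms by (cases a; cases b) (auto simp: ennpowr_ennreal powr_mono2 top_unique)
qed simp

lemma ennpowr_mult:
  assumes "0 < r"
  shows "ennpowr (a * b) r = ennpowr a r * ennpowr b r"
proof -
  have eq: "ennpowr x r = 0 \<longleftrightarrow> x = 0" for x
    by (cases x) (auto simp: ennpowr_ennreal)
  show ?thesis
  proof (cases "a = top \<or> b = top")
    case True
    then show ?thesis
      by (auto simp: ennreal_top_mult ennreal_mult_top eq)
  next
    case False
    then show ?thesis
      by (cases a; cases b) (auto simp: ennpowr_ennreal ennreal_mult[symmetric] powr_mult)
  qed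
qed

lemma ennpowr_ennpowr: "ennpowr (ennpowr a r) s = ennpowr a (r * s)"
  by (cases a) (auto simp: ennpowr_ennreal powr_powr)

lemma ennpowr_1 [simp]: "ennpowr a 1 = a"
  by (cases a) (auto simp: ennpowr_ennreal)

lemma ennpowr_add_le:
  assumes "0 < r"
  shows "ennpowr (a + b) r \<le> ennreal (2 powr r) * (ennpowr a r + ennpowr b r)"
proof -
  have "a + b \<le> ennreal 2 * max a b"
    by (metis add_mono ennreal_numeral max.cobounded1 max.cobounded2 mult_2 zero_le_numeral)
  then have "ennpowr (a + b) r \<le> ennpowr (ennreal 2 * max a b) r"
    using assms by (rule ennpowr_mono)
  also have "\<dots> = ennreal (2 powr r) * ennpowr (max a b) r"
    using assms by (simp add: ennpowr_mult ennpowr_ennreal del: ennreal_numeral)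
  also have "\<dots> \<le> ennreal (2 powr r) * (ennpowr a r + ennpowr b r)"
    by (intro mult_left_mono) (auto simp: max_def)
  finally show ?thesis .
qed

lemma powr_superadditive:
  fixes a b r :: real
  assumes "1 \<le> r" "0 \<le> a" "0 \<le> b"
  shows "a powr r + b powr r \<le> (a + b) powr r"
proof -
  have *: "x powr r = x * x powr (r - 1)" if "0 \<le> x" for x :: real
    using that powr_mult_base[of x "r - 1"] by simp
  have "a powr r + b powr r = a * a powr (r - 1) + b * b powr (r - 1)"
    using assms by (simp add: *)
  also have "\<dots> \<le> a * (a + b) powr (r - 1) + b * (a + b) powr (r - 1)"
    using assms by (intro add_mono mult_left_mono powr_mono2) auto
  also have "\<dots> = (a + b) powr r"
    using assms by (simp add: * algebra_simps)
  finally show ?thesis .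
qed

lemma ennpowr_superadditive:
  assumes "1 \<le> r"
  shows "ennpowr a r + ennpowr b r \<le> ennpowr (a + b) r"
  using assms
  by (cases a; cases b)
     (auto simp: ennpowr_ennreal ennreal_plus[symmetric] powr_superadditive simp del: ennreal_plus)

lemma sum_ennpowr_le:
  assumes "1 \<le> r"
  shows "(\<Sum>i\<in>F. ennpowr (f i) r) \<le> ennpowr (\<Sum>i\<in>F. f i) r"
proof (induction F rule: infinite_finite_induct)
  case (insert x F)
  have "(\<Sum>i\<in>insert x F. ennpowr (f i) r) \<le> ennpowr (f x) r + ennpowr (\<Sum>i\<in>F. f i) r"
    using insert by (simp add: add_left_mono)
  also have "\<dots> \<le> ennpowr (\<Sum>i\<in>insert x F. f i) r"
    using insert ennpowr_superadditive[OF assms] by simp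
  finally show ?case .
qed auto

lemma powr_add_le:
  fixes a b r :: real
  assumes "0 \<le> a" "0 \<le> b" "0 \<le> r"
  shows "(a + b) powr r \<le> 2 powr r * (a powr r + b powr r)"
proof -
  have "(a + b) powr r \<le> (2 * max a b) powr r"
    using assms by (intro powr_mono2) auto
  also have "\<dots> = 2 powr r * max a b powr r"
    using assms by (simp add: powr_mult)
  also have "\<dots> \<le> 2 powr r * (a powr r + b powr r)"
    by (intro mult_left_mono) (auto simp: max_def)
  finally show ?thesis .
qed

lemma powr_sum_superadditive:
  fixes f :: "'a \<Rightarrow> real"
  assumes "1 \<le> r" "\<And>i. i \<in> F \<Longrightarrow> 0 \<le> f i"
  shows "(\<Sum>i\<in>F. f i powr r) \<le> (\<Sum>i\<in>F. f i) powr r"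
  using assms(2)
proof (induction F rule: infinite_finite_induct)
  case (insert x F)
  have "(\<Sum>i\<in>insert x F. f i powr r) \<le> f x powr r + (\<Sum>i\<in>F. f i) powr r"
    using insert by simp
  also have "\<dots> \<le> (\<Sum>i\<in>insert x F. f i) powr r"
    using insert powr_superadditive[OF assms(1), of "f x" "\<Sum>i\<in>F. f i"] by (simp add: sum_nonneg)
  finally show ?case .
qed auto

lemma nn_integral_count_space_le:
  fixes f :: "'i \<Rightarrow> ennreal"
  assumes "countable A" and bd: "\<And>F. finite F \<Longrightarrow> F \<subseteq> A \<Longrightarrow> sum f F \<le> B"
  shows "(\<integral>\<^sup>+i. f i \<partial>count_space A) \<le> B"
proof (cases "finite A")
  case True
  then show ?thesis by (simp add: nn_integral_count_space_finite bd)
next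
  case False
  have bij: "bij_betw (from_nat_into A) UNIV A"
    using bij_betw_from_nat_into[OF assms(1) False] .
  have "(\<integral>\<^sup>+i. f i \<partial>count_space A) = (\<integral>\<^sup>+n. f (from_nat_into A n) \<partial>count_space UNIV)"
    using nn_integral_bij_count_space[OF bij] by simp
  also have "\<dots> = (\<Sum>n. f (from_nat_into A n))"
    by (rule nn_integral_count_space_nat)
  also have "\<dots> \<le> B"
  proof (rule suminf_le_const)
    show "summable (\<lambda>n. f (from_nat_into A n))" by simp
    fix n
    have inj: "inj_on (from_nat_into A) {..<n}"
      using bij by (meson bij_betw_def inj_on_subset subset_UNIV)
    have "(\<Sum>i<n. f (from_nat_into A i)) = sum f (from_nat_into A ` {..<n})"
      using inj by (simp add: sum.reindex)
    also have "\<dots> \<le> B"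
      using bij by (intro bd) (auto simp: bij_betw_def)
    finally show "(\<Sum>i<n. f (from_nat_into A i)) \<le> B" .
  qed
  finally show ?thesis .
qed

lemma finite_sum_le_infsum_ennreal:
  fixes f :: "'i \<Rightarrow> ennreal"
  shows "finite F \<Longrightarrow> F \<subseteq> A \<Longrightarrow> sum f F \<le> infsum f A"
  by (subst nonneg_infsum_complete) (auto intro!: SUP_upper)

lemma infsum_le_ennreal:
  fixes f :: "'i \<Rightarrow> ennreal"
  assumes "\<And>F. finite F \<Longrightarrow> F \<subseteq> A \<Longrightarrow> sum f F \<le> B"
  shows "infsum f A \<le> B"
  by (rule infsum_le_finite_sums) (auto simp: assms intro: nonneg_summable_on_complete)

section \<open>Test functions, energy and capacity\<close>

lemma C0_subset:
  assumes u: "u \<in> C0 G" and v: "continuous_on G v" and sub: "\<And>x. x \<in> G \<Longrightarrow> v x \<noteq> 0 \<Longrightarrow> u x \<noteq> 0"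
  shows "v \<in> C0 G"
proof -
  have "closure {x\<in>G. v x \<noteq> 0} \<subseteq> closure {x\<in>G. u x \<noteq> 0}"
    using sub by (intro closure_mono) auto
  moreover from this have "compact (closure {x\<in>G. v x \<noteq> 0})"
    using u compact_Int_closed[of "closure {x\<in>G. u x \<noteq> 0}" "closure {x\<in>G. v x \<noteq> 0}"]
    by (simp add: C0_def inf.absorb2)
  ultimately show ?thesis
    using u v by (auto simp: C0_def)
qed

lemma C0_compose:
  fixes f :: "real \<Rightarrow> real"
  assumes u: "u \<in> C0 G" and f: "continuous_on UNIV f" "f 0 = 0"
  shows "(\<lambda>x. f (u x)) \<in> C0 G"
proof (rule C0_subset[OF u])
  show "continuous_on G (\<lambda>x. f (u x))"
    using u by (intro continuous_on_compose2[OF f(1)]) (auto simp: C0_def)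
qed (use f in auto)

text \<open>Values outside \<open>G\<close> are arbitrary, so a test function need not be measurable as a total function.
  Its extension by zero is, with the same energy by \<open>frac_energy_cong\<close>; this is what makes Tonelli's theorem available
  below.\<close>

lemma C0_zero_extension:
  assumes u: "u \<in> C0 G" and "open G"
  shows "(\<lambda>x. if x \<in> G then u x else 0) \<in> C0 G"
    and "(\<lambda>x. if x \<in> G then u x else 0) \<in> borel_measurable borel"
proof -
  have c: "continuous_on G u" using u by (simp add: C0_def)
  have "continuous_on G (\<lambda>x. if x \<in> G then u x else 0)"
    using c by (rule continuous_on_eq) auto
  then show "(\<lambda>x. if x \<in> G then u x else 0) \<in> C0 G"
    by (rule C0_subset[OF u]) auto
  show "(\<lambda>x. if x \<in> G then u x else 0) \<in> borel_measurable borel"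
    using c \<open>open G\<close> by (intro borel_measurable_continuous_on_if) auto
qed

lemma C0_superlevel_compact:
  assumes u: "u \<in> C0 G" and t: "0 < t"
  shows "compact {x\<in>G. t \<le> u x}"
proof -
  let ?S = "closure {x\<in>G. u x \<noteq> 0}"
  have S: "compact ?S" "?S \<subseteq> G" and cont: "continuous_on ?S u"
    using u continuous_on_subset by (auto simp: C0_def)
  have "{x\<in>G. t \<le> u x} = ?S \<inter> u -` {t..}"
    using S(2) t closure_subset[of "{x\<in>G. u x \<noteq> 0}"] by fastforce
  moreover have "closed (?S \<inter> u -` {t..})"
    using cont by (intro continuous_closed_preimage) auto
  ultimately show ?thesis
    using S(1) compact_Int_closed[of ?S "?S \<inter> u -` {t..}"] by (simp add: inf.left_idem)
qed

lemma frac_energy_cong: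
  fixes G :: "(real ^ 'n) set"
  assumes "\<And>x. x \<in> G \<Longrightarrow> u x = v x"
  shows "frac_energy \<delta> p G u = frac_energy \<delta> p G v"
proof -
  have "(\<integral>\<^sup>+y\<in>G. ennreal (\<bar>u x - u y\<bar> powr p / norm (x - y) powr (real CARD('n) + \<delta> * p)) \<partial>lborel) =
        (\<integral>\<^sup>+y\<in>G. ennreal (\<bar>v x - v y\<bar> powr p / norm (x - y) powr (real CARD('n) + \<delta> * p)) \<partial>lborel)"
    if "x \<in> G" for x
    using that assms by (intro nn_integral_cong) (auto simp: indicator_def)
  then show ?thesis
    unfolding frac_energy_def by (intro nn_integral_cong) (auto simp: indicator_def)
qed

lemma frac_energy_cmult:
  fixes u :: "real ^ 'n \<Rightarrow> real"
  assumes [measurable]: "u \<in> borel_measurable borel" "D \<in> sets borel" and c: "0 \<le> c"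
  shows "frac_energy \<delta> p D (\<lambda>x. c * u x) = ennreal (c powr p) * frac_energy \<delta> p D u"
proof -
  have eq: "\<bar>c * u x - c * u y\<bar> powr p / t = c powr p * (\<bar>u x - u y\<bar> powr p / t)" for x y t
    using c by (simp add: right_diff_distrib[symmetric] abs_mult powr_mult)
  show ?thesis
    unfolding frac_energy_def eq
    by (simp add: ennreal_mult' mult.assoc nn_integral_cmult del: times_divide_eq_right)
qed

text \<open>The infimum may range over the empty set, where the capacity is \<open>\<infinity>\<close>; dividing by \<open>C\<close> covers this
  case too.\<close>

lemma le_mult_frac_cap:
  assumes C: "0 < C"
    and le: "\<And>u. u \<in> C0 G \<Longrightarrow> (\<And>x. x \<in> K \<Longrightarrow> 1 \<le> u x) \<Longrightarrow> a \<le> ennreal C * frac_energy \<delta> p G u"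
  shows "a \<le> ennreal C * frac_cap \<delta> p K G"
proof -
  have inv: "ennreal (1 / C) * ennreal C = 1"
    using C by (simp add: ennreal_mult[symmetric])
  have "ennreal (1 / C) * a \<le> frac_cap \<delta> p K G"
    unfolding frac_cap_def
  proof (rule INF_greatest)
    fix u assume "u \<in> {u \<in> C0 G. \<forall>x\<in>K. 1 \<le> u x}"
    then have "ennreal (1 / C) * a \<le> ennreal (1 / C) * (ennreal C * frac_energy \<delta> p G u)"
      by (intro mult_left_mono le) auto
    then show "ennreal (1 / C) * a \<le> frac_energy \<delta> p G u"
      by (simp add: mult.assoc[symmetric] inv)
  qed
  then have "ennreal C * (ennreal (1 / C) * a) \<le> ennreal C * frac_cap \<delta> p K G"
    by (rule mult_left_mono) simp
  then show ?thesis
    by (simp add: mult.assoc[symmetric] mult.commute[of "ennreal C"] inv)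
qed

lemma frac_cap_le:
  "u \<in> C0 G \<Longrightarrow> (\<And>x. x \<in> K \<Longrightarrow> 1 \<le> u x) \<Longrightarrow> frac_cap \<delta> p K G \<le> frac_energy \<delta> p G u"
  unfolding frac_cap_def by (rule INF_lower) auto

section \<open>Measure density of unbounded John domains\<close>

text \<open>The chord is the polygon with the single edge from \<open>\<gamma> 0\<close> to \<open>\<gamma> t\<close>.\<close>

lemma arc_length_dist_le:
  assumes "arc_length_parametrized \<gamma> l" "0 \<le> t" "t \<le> l"
  shows "dist (\<gamma> 0) (\<gamma> t) \<le> t"
proof -
  let ?T = "\<lambda>i::nat. if i = 0 then 0 else t"
  have "ennreal (dist (\<gamma> 0) (\<gamma> t)) = ennreal (\<Sum>i<1. dist (\<gamma> (?T i)) (\<gamma> (?T (Suc i))))"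
    by simp
  also have "\<dots> \<le> curve_length \<gamma> 0 t"
    unfolding curve_length_def
    using assms(2) by (intro SUP_upper2[of "(1, ?T)"]) (auto simp: mono_on_def)
  also have "\<dots> = ennreal t"
    using assms by (simp add: arc_length_parametrized_def)
  finally show ?thesis
    using assms(2) by simp
qed

lemma ball_subset_of_infdist_frontier:
  fixes D :: "'a::euclidean_space set"
  assumes "x \<in> D" "r \<le> infdist x (frontier D)"
  shows "ball x r \<subseteq> D"
proof (cases "r > 0")
  case True
  show ?thesis
  proof (rule ccontr)
    assume "\<not> ball x r \<subseteq> D"
    then have "ball x r \<inter> frontier D \<noteq> {}"
      using True assms(1) by (intro connected_Int_frontier) (auto intro: centre_in_ball[THEN iffD2])
    then obtain z where "z \<in> frontier D" "dist x z < r" by auto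
    then show False
      using infdist_le[of z "frontier D" x] assms(2) by simp
  qed
next
  case False
  then show ?thesis by (simp add: ball_empty)
qed

text \<open>Join \<open>x\<close> to a point at distance at least \<open>r\<close>; such a point exists because \<open>D\<close> is unbounded.  The
  John curve has length at least \<open>r\<close>, so its point at arc length \<open>r/2\<close> lies within \<open>r/2\<close> of \<open>x\<close>
  and has distance at least \<open>r/(2c)\<close> to the boundary.  The ball of radius \<open>r/(2c)\<close> around it is
  contained in \<open>D \<inter> B(x, r)\<close>.\<close>

lemma john_domain_measure_density:
  fixes D :: "(real ^ 'n) set"
  assumes J: "john_domain c D" and c: "1 \<le> c" and D: "\<not> bounded D"
  obtains \<kappa> where "\<kappa> > 0"
    "\<And>x r. x \<in> D \<Longrightarrow> 0 < r \<Longrightarrow> ennreal (\<kappa> * r ^ CARD('n)) \<le> emeasure lborel (D \<inter> ball x r)"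
proof
  let ?n = "CARD('n)"
  define \<kappa> where "\<kappa> = unit_ball_vol (real ?n) / (2 * c) ^ ?n"
  show "\<kappa> > 0" using c by (simp add: \<kappa>_def unit_ball_vol_pos)
  fix x r assume x: "x \<in> D" and r: "(0::real) < r"
  have "open D" using J by (simp add: john_domain_def)
  obtain x2 where x2: "x2 \<in> D" "r \<le> dist x x2"
    using D by (meson bounded_subset[OF bounded_ball[of x r]] mem_ball not_le_imp_less subsetI)
  obtain \<gamma> l where g: "arc_length_parametrized \<gamma> l" "\<gamma> ` {0..l} \<subseteq> D" "\<gamma> 0 = x" "\<gamma> l = x2"
    and gd: "\<And>t. t \<in> {0..l} \<Longrightarrow> min t (l - t) / c \<le> infdist (\<gamma> t) (frontier D)"
    using J x x2(1) unfolding john_domain_def by metis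
  have "0 \<le> l" using g(1) by (simp add: arc_length_parametrized_def)
  then have l: "r \<le> l"
    using arc_length_dist_le[OF g(1), of l] x2 g(3,4) by simp
  let ?z = "\<gamma> (r / 2)"
  have z: "?z \<in> D" using g(2) r l by auto
  have "r / (2 * c) \<le> infdist ?z (frontier D)"
    using gd[of "r / 2"] r l by (simp add: min_def split: if_splits)
  then have sub: "ball ?z (r / (2 * c)) \<subseteq> D"
    using z by (rule ball_subset_of_infdist_frontier[rotated])
  have "dist x ?z \<le> r / 2"
    using arc_length_dist_le[OF g(1), of "r / 2"] g(3) r l by simp
  moreover have "r / (2 * c) \<le> r / 2"
    using c r by (simp add: field_simps)
  ultimately have sub2: "ball ?z (r / (2 * c)) \<subseteq> ball x r"
    by (subst ball_subset_ball_iff) (auto simp: dist_commute)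
  have "ennreal (\<kappa> * r ^ ?n) = emeasure lborel (ball ?z (r / (2 * c)))"
    using r c by (simp add: emeasure_ball \<kappa>_def power_divide)
  also have "\<dots> \<le> emeasure lborel (D \<inter> ball x r)"
    using sub sub2 \<open>open D\<close> by (intro emeasure_mono) auto
  finally show "ennreal (\<kappa> * r ^ ?n) \<le> emeasure lborel (D \<inter> ball x r)" .
qed

section \<open>Weak fractional Sobolev inequality\<close>

text \<open>Choose \<open>r\<close> with \<open>\<kappa>r\<^sup>n = 2b\<close>.  By measure density, at least the measure \<open>b\<close> of \<open>D \<inter> B(x, r)\<close> lies
  outside \<open>B\<close>, and there the kernel is at least \<open>r\<^sup>-\<^sup>s\<close>.\<close>

lemma kernel_integral_lower_bound:
  fixes D B :: "(real ^ 'n) set"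
  assumes "open D" and \<kappa>: "0 < \<kappa>"
    and dens: "\<And>r. 0 < r \<Longrightarrow> ennreal (\<kappa> * r ^ CARD('n)) \<le> emeasure lborel (D \<inter> ball x r)"
    and B: "B \<in> sets borel" "emeasure lborel B = ennreal b" "0 < b" and s: "0 \<le> s"
  shows "ennreal (b * (2 * b / \<kappa>) powr - (s / real CARD('n)))
          \<le> (\<integral>\<^sup>+y\<in>D - B. ennreal (1 / norm (x - y) powr s) \<partial>lborel)"
proof -
  let ?n = "CARD('n)"
  define r where "r = (2 * b / \<kappa>) powr (1 / real ?n)"
  have r: "r > 0" using \<kappa> B(3) by (simp add: r_def)
  have "r ^ ?n = 2 * b / \<kappa>"
    using r \<kappa> B(3) by (simp add: r_def powr_realpow[symmetric] powr_powr)
  then have rn: "\<kappa> * r ^ ?n = 2 * b" using \<kappa> by simp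
  have rs: "1 / r powr s = (2 * b / \<kappa>) powr - (s / real ?n)"
    using \<kappa> B(3) by (simp add: r_def powr_powr powr_minus_divide)
  \<comment> \<open>The point \<open>x\<close> is a null set; it is removed because the kernel takes the value \<open>1 / 0 = 0\<close> there.\<close>
  define S where "S = (D \<inter> ball x r) - B - {x}"
  have Sm: "S \<in> sets borel" using \<open>open D\<close> B(1) by (auto simp: S_def)
  have "ennreal (2 * b) \<le> emeasure lborel (D \<inter> ball x r)"
    using dens[OF r] rn by simp
  also have "\<dots> \<le> emeasure lborel (S \<union> (B \<union> {x}))"
    using Sm B(1) by (intro emeasure_mono) (auto simp: S_def)
  also have "\<dots> \<le> emeasure lborel S + (emeasure lborel B + emeasure lborel {x})"
    using Sm B(1) by (intro order_trans[OF emeasure_subadditive] add_left_mono emeasure_subadditive) auto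
  also have "\<dots> = emeasure lborel S + ennreal b"
    using B(2) by simp
  finally have "ennreal b \<le> emeasure lborel S"
    using B(3) by (cases "emeasure lborel S") (auto simp: ennreal_plus[symmetric] simp del: ennreal_plus)
  then have "ennreal (b * (1 / r powr s)) \<le> ennreal (1 / r powr s) * emeasure lborel S"
    using B(3) by (simp add: ennreal_mult mult.commute mult_right_mono del: times_divide_eq_right)
  also have "\<dots> = (\<integral>\<^sup>+y\<in>S. ennreal (1 / r powr s) \<partial>lborel)"
    using Sm by (simp add: nn_integral_cmult_indicator)
  also have "\<dots> \<le> (\<integral>\<^sup>+y\<in>D - B. ennreal (1 / norm (x - y) powr s) \<partial>lborel)"
  proof (intro nn_integral_mono)
    fix y
    show "ennreal (1 / r powr s) * indicator S y \<le> ennreal (1 / norm (x - y) powr s) * indicator (D - B) y"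
    proof (cases "y \<in> S")
      case True
      then have "y \<in> D - B" "0 < norm (x - y)" "norm (x - y) \<le> r"
        by (auto simp: S_def dist_norm)
      then show ?thesis
        using True s r by (auto intro!: ennreal_leI divide_left_mono powr_mono2)
    qed simp
  qed
  finally show ?thesis
    by (simp only: rs)
qed

text \<open>The interaction between \<open>A\<close> and \<open>D - B\<close> alone contributes this much.  For \<open>B\<close> of small
  measure the bound is large, since the total factor in \<open>b\<close> is \<open>b\<^sup>-\<^sup>\<delta>\<^sup>p\<^sup>/\<^sup>n\<close>.\<close>

lemma level_set_energy_lower_bound:
  fixes D A B :: "(real ^ 'n) set"
  assumes "open D" and \<kappa>: "0 < \<kappa>"
    and dens: "\<And>x r. x \<in> D \<Longrightarrow> 0 < r \<Longrightarrow> ennreal (\<kappa> * r ^ CARD('n)) \<le> emeasure lborel (D \<inter> ball x r)"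
    and A: "A \<in> sets borel" "A \<subseteq> D"
    and B: "B \<in> sets borel" "emeasure lborel B = ennreal b" "0 < b"
    and p: "0 \<le> p" "0 \<le> \<delta>" and h: "0 < h" "\<And>x y. x \<in> A \<Longrightarrow> y \<in> D - B \<Longrightarrow> h \<le> \<bar>v x - v y\<bar>"
  shows "ennreal (h powr p * (b * (2 * b / \<kappa>) powr - ((real CARD('n) + \<delta> * p) / real CARD('n))))
           * emeasure lborel A \<le> frac_energy \<delta> p D v"
proof -
  let ?s = "real CARD('n) + \<delta> * p"
  let ?c = "b * (2 * b / \<kappa>) powr - (?s / real CARD('n))"
  have DB [measurable]: "D - B \<in> sets borel"
    using \<open>open D\<close> B(1) by auto
  have *: "ennreal (h powr p * ?c) \<le>
      (\<integral>\<^sup>+y\<in>D. ennreal (\<bar>v x - v y\<bar> powr p / norm (x - y) powr ?s) \<partial>lborel)" if x: "x \<in> A" for x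
  proof -
    have "ennreal (h powr p * ?c) = ennreal (h powr p) * ennreal ?c"
      by (simp add: ennreal_mult B(3) less_imp_le)
    also have "\<dots> \<le> ennreal (h powr p) * (\<integral>\<^sup>+y\<in>D - B. ennreal (1 / norm (x - y) powr ?s) \<partial>lborel)"
      using x A p by (intro mult_left_mono kernel_integral_lower_bound assms dens) auto
    also have "\<dots> = (\<integral>\<^sup>+y\<in>D - B. ennreal (h powr p / norm (x - y) powr ?s) \<partial>lborel)"
      using DB
      by (subst nn_integral_cmult[symmetric])
         (auto simp: ennreal_mult'[symmetric] mult.assoc[symmetric])
    also have "\<dots> \<le> (\<integral>\<^sup>+y\<in>D. ennreal (\<bar>v x - v y\<bar> powr p / norm (x - y) powr ?s) \<partial>lborel)"
      using h p x by (intro nn_integral_mono)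
        (auto simp: indicator_def intro!: ennreal_leI divide_right_mono powr_mono2)
    finally show ?thesis .
  qed
  have "ennreal (h powr p * ?c) * emeasure lborel A = (\<integral>\<^sup>+x\<in>A. ennreal (h powr p * ?c) \<partial>lborel)"
    using A by (simp add: nn_integral_cmult_indicator)
  also have "\<dots> \<le> frac_energy \<delta> p D v"
    unfolding frac_energy_def using A(2) *
    by (intro nn_integral_mono) (auto simp: indicator_def)
  finally show ?thesis .
qed

text \<open>Let \<open>a\<^sub>j\<close> be the measure of \<open>A\<^sub>j = {v \<ge> 2\<^sup>-\<^sup>j}\<close>.  The previous lemma for \<open>A\<^sub>j\<close> and \<open>A\<^sub>j\<^sub>+\<^sub>1\<close> yields
  \<open>c 2\<^sup>-\<^sup>(\<^sup>j\<^sup>+\<^sup>1\<^sup>)\<^sup>p a\<^sub>j a\<^sub>j\<^sub>+\<^sub>1\<^sup>-\<^sup>\<theta> \<le> E(v)\<close>.  All \<open>a\<^sub>j\<close> are bounded by the measure of the support, so the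
  supremum \<open>M\<close> of \<open>2\<^sup>-\<^sup>j\<^sup>\<sigma> a\<^sub>j\<close> is finite for every \<open>\<sigma> > 0\<close>.  At an index \<open>j\<close> that almost attains
  it, \<open>a\<^sub>j\<close> is at least \<open>2\<^sup>j\<^sup>\<sigma>M/2\<close> while \<open>a\<^sub>j\<^sub>+\<^sub>1\<close> is at most \<open>2\<^sup>(\<^sup>j\<^sup>+\<^sup>1\<^sup>)\<^sup>\<sigma>M\<close>.  With
  \<open>\<sigma>(1 - \<theta>) = p\<close> the powers of \<open>2\<^sup>j\<close> cancel and \<open>M\<^sup>1\<^sup>-\<^sup>\<theta> \<le> C E(v)\<close> remains; finally
  \<open>\<bar>K\<bar> \<le> a\<^sub>0 \<le> M\<close>.\<close>

lemma weak_fractional_sobolev: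
  fixes D :: "(real ^ 'n) set"
  assumes "open D" and \<kappa>: "0 < \<kappa>"
    and dens: "\<And>x r. x \<in> D \<Longrightarrow> 0 < r \<Longrightarrow> ennreal (\<kappa> * r ^ CARD('n)) \<le> emeasure lborel (D \<inter> ball x r)"
    and p: "0 < p" "0 < \<delta>" "p < real CARD('n) / \<delta>"
  obtains C where "C > 0"
    "\<And>K. compact K \<Longrightarrow> K \<subseteq> D \<Longrightarrow>
       ennreal (measure lborel K powr (1 - \<delta> * p / real CARD('n))) \<le> ennreal C * frac_cap \<delta> p K D"
proof -
  let ?n = "real CARD('n)"
  define \<theta> where "\<theta> = \<delta> * p / ?n"
  have \<theta>: "0 < \<theta>" "\<theta> < 1" using p by (simp_all add: \<theta>_def field_simps)
  define \<sigma> where "\<sigma> = p / (1 - \<theta>)"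
  have \<sigma>: "\<sigma> > 0" "\<sigma> * (1 - \<theta>) = p" using \<theta> p by (simp_all add: \<sigma>_def)
  define c where "c = (\<kappa> / 2) powr (1 + \<theta>)"
  have c: "c > 0" using \<kappa> by (simp add: c_def)
  define C where "C = 2 * 2 powr (p + \<sigma> * \<theta>) / c"
  have C: "C > 0" using c by (simp add: C_def)
  have main: "ennreal (measure lborel K powr (1 - \<theta>)) \<le> ennreal C * frac_energy \<delta> p D v"
    if v: "v \<in> C0 D" and K: "compact K" "K \<subseteq> D" "\<And>x. x \<in> K \<Longrightarrow> 1 \<le> v x" for v K
  proof (cases "frac_energy \<delta> p D v")
    case top
    then show ?thesis using C by (simp add: ennreal_mult_top)
  next
    case (real e)
    define A where "A = (\<lambda>j::nat. {x\<in>D. 2 powr - real j \<le> v x})"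
    define a where "a = (\<lambda>j. measure lborel (A j))"
    have Ac: "compact (A j)" for j
      unfolding A_def using v by (intro C0_superlevel_compact) auto
    then have Ab: "A j \<in> sets borel" for j by (simp add: borel_compact)
    have Ae: "emeasure lborel (A j) = ennreal (a j)" for j
      unfolding a_def using emeasure_compact_finite[OF Ac[of j]] by (simp add: emeasure_eq_ennreal_measure less_top)
    have mono: "measure lborel X \<le> measure lborel Y" if "X \<subseteq> Y" "compact X" "compact Y" for X Y :: "(real^'n) set"
      using that by (intro measure_mono_fmeasurable)
        (auto intro: fmeasurable_compact simp: borel_compact)
    let ?S = "closure {x\<in>D. v x \<noteq> 0}"
    have aS: "a j \<le> measure lborel ?S" for j
      unfolding a_def using v Ac
    proof (intro mono)
      show "A j \<subseteq> ?S"
        using closure_subset[of "{x\<in>D. v x \<noteq> 0}"] unfolding A_def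
        by (smt (verit) mem_Collect_eq powr_gt_zero subset_iff)
    qed (auto simp: C0_def)
    have "K \<subseteq> A 0" using K by (auto simp: A_def)
    then have Ka: "measure lborel K \<le> a 0" unfolding a_def using K Ac by (intro mono)
    show ?thesis
    proof (cases "a 0 > 0")
      case False
      then have "measure lborel K = 0" using Ka by (metis measure_nonneg order_antisym_conv linorder_not_le order_trans)
      then show ?thesis by simp
    next
      case True
      have apos: "a j > 0" for j
      proof -
        have "2 powr - real j \<le> 1" using powr_mono[of "- real j" 0 2] by simp
        then have "A 0 \<subseteq> A j" by (auto simp: A_def)
        then show ?thesis using True mono[of "A 0" "A j"] Ac by (auto simp: a_def)
      qed
      define g where "g = (\<lambda>j. a j * 2 powr - (real j * \<sigma>))"
      have "g j \<le> measure lborel ?S" for j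
      proof -
        have "g j \<le> a j * 1"
          unfolding g_def using \<sigma> apos[of j] powr_mono[of "- (real j * \<sigma>)" 0 2]
          by (intro mult_left_mono) auto
        then show ?thesis using aS[of j] by simp
      qed
      then have bdd: "bdd_above (range g)" by (intro bdd_aboveI[of _ "measure lborel ?S"]) auto
      define M where "M = (SUP j. g j)"
      have gM: "g j \<le> M" for j
        unfolding M_def using bdd by (intro cSUP_upper) auto
      have a0M: "a 0 \<le> M" using gM[of 0] by (simp add: g_def)
      have M: "M > 0" using a0M True by simp
      then have "M / 2 < M" by simp
      then obtain j where j: "M / 2 < g j"
        unfolding M_def using bdd by (subst (asm) less_cSUP_iff) auto
      define h where "h = 2 powr - real (Suc j)"
      have "ennreal (h powr p * (a (Suc j) * (2 * a (Suc j) / \<kappa>) powr - ((?n + \<delta> * p) / ?n)))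
           * emeasure lborel (A j) \<le> frac_energy \<delta> p D v"
      proof (rule level_set_energy_lower_bound[OF \<open>open D\<close> \<kappa> dens Ab _ Ab Ae apos])
        show "A j \<subseteq> D" by (auto simp: A_def)
        show "h > 0" by (simp add: h_def)
        fix x y assume "x \<in> A j" "y \<in> D - A (Suc j)"
        moreover have "2 powr - real j = 2 * h"
          by (simp add: h_def powr_diff powr_minus field_simps powr_add)
        ultimately show "h \<le> \<bar>v x - v y\<bar>" by (auto simp: A_def h_def)
      qed (use p in auto)
      then have "ennreal (h powr p * (a (Suc j) * (2 * a (Suc j) / \<kappa>) powr - ((?n + \<delta> * p) / ?n)) * a j) \<le> ennreal e"
        using apos[of j] apos[of "Suc j"] by (simp add: Ae real ennreal_mult'' less_imp_le)
      then have le: "h powr p * (a (Suc j) * (2 * a (Suc j) / \<kappa>) powr - ((?n + \<delta> * p) / ?n)) * a j \<le> e"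
        using real by simp
      have eq1: "a (Suc j) * (2 * a (Suc j) / \<kappa>) powr - ((?n + \<delta> * p) / ?n) = c * a (Suc j) powr - \<theta>"
      proof -
        have "(?n + \<delta> * p) / ?n = 1 + \<theta>" by (simp add: \<theta>_def field_simps)
        moreover have "(2 * a (Suc j) / \<kappa>) powr - (1 + \<theta>) = c * a (Suc j) powr - (1 + \<theta>)"
          using apos[of "Suc j"] \<kappa> by (simp add: c_def powr_divide powr_mult powr_minus field_simps flip: powr_add)
        moreover have "a (Suc j) * a (Suc j) powr - (1 + \<theta>) = a (Suc j) powr - \<theta>"
          using apos[of "Suc j"] powr_mult_base[of "a (Suc j)" "- (1 + \<theta>)"] by simp
        ultimately show ?thesis by simp
      qed
      have up: "a (Suc j) \<le> M * 2 powr (real (Suc j) * \<sigma>)"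
        using gM[of "Suc j"] by (simp add: g_def powr_minus field_simps)
      have lo: "M / 2 * 2 powr (real j * \<sigma>) \<le> a j"
        using j by (simp add: g_def powr_minus field_simps)
      \<comment> \<open>The constant \<open>C\<close> is chosen to make this an identity, thanks to \<open>\<sigma>(1 - \<theta>) = p\<close>.\<close>
      have "M powr (1 - \<theta>) = C * (2 powr (- real (Suc j) * p) * (c * (M * 2 powr (real (Suc j) * \<sigma>)) powr - \<theta>)
              * (M / 2 * 2 powr (real j * \<sigma>)))"
      proof -
        have "M powr (1 - \<theta>) = M powr - \<theta> * M"
          using M powr_mult_base[of M "-\<theta>"] by (simp add: mult.commute)
        moreover have "2 powr (p + \<sigma> * \<theta>) * 2 powr (- real (Suc j) * p) * 2 powr (real (Suc j) * \<sigma> * - \<theta>) * 2 powr (real j * \<sigma>) = 1"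
        proof -
          have "p + \<sigma> * \<theta> + - real (Suc j) * p + real (Suc j) * \<sigma> * - \<theta> + real j * \<sigma> = 0"
            by (subst (1 2) \<sigma>(2)[symmetric]) (simp add: algebra_simps)
          then show ?thesis by (simp only: powr_add[symmetric]) simp
        qed
        ultimately show ?thesis
          using c M by (simp add: C_def powr_mult powr_powr field_simps)
      qed
      also have "\<dots> \<le> C * (h powr p * (c * a (Suc j) powr - \<theta>) * a j)"
      proof -
        have "(M * 2 powr (real (Suc j) * \<sigma>)) powr - \<theta> \<le> a (Suc j) powr - \<theta>"
          using up apos[of "Suc j"] \<theta> by (intro powr_mono2') auto
        moreover have "h powr p = 2 powr (- real (Suc j) * p)" by (simp add: h_def powr_powr)
        ultimately show ?thesis
          using lo C c M by (intro mult_left_mono mult_mono) auto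
      qed
      also have "\<dots> \<le> C * e"
        using le C unfolding eq1 by (intro mult_left_mono) auto
      finally have "M powr (1 - \<theta>) \<le> C * e" .
      moreover have "measure lborel K powr (1 - \<theta>) \<le> M powr (1 - \<theta>)"
        using Ka a0M \<theta> by (intro powr_mono2) auto
      ultimately show ?thesis
        using C real by (simp add: ennreal_mult[symmetric] ennreal_leI)
    qed
  qed
  show ?thesis
  proof (rule that[OF C])
    fix K :: "(real^'n) set" assume K: "compact K" "K \<subseteq> D"
    have "ennreal (measure lborel K powr (1 - \<theta>)) \<le> ennreal C * frac_cap \<delta> p K D"
      using main K by (intro le_mult_frac_cap[OF C]) auto
    then show "ennreal (measure lborel K powr (1 - \<delta> * p / ?n)) \<le> ennreal C * frac_cap \<delta> p K D"
      by (simp add: \<theta>_def)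
  qed
qed

section \<open>Truncation into dyadic layers\<close>

text \<open>For \<open>t \<ge> 0\<close> this is the part of \<open>t\<close> between the heights \<open>2\<^sup>k\<^sup>-\<^sup>1\<close> and \<open>2\<^sup>k\<close>, that is, Maz'ya's
  truncation of \<open>t - 2\<^sup>k\<^sup>-\<^sup>1\<close> to \<open>[0, 2\<^sup>k\<^sup>-\<^sup>1]\<close>.  Written as a difference of minima, it telescopes in \<open>k\<close>.\<close>

definition layer :: "int \<Rightarrow> real \<Rightarrow> real" where
  "layer k t = min t (2 powr real_of_int k) - min t (2 powr (real_of_int k - 1))"

lemma layer_mono: "s \<le> t \<Longrightarrow> layer k s \<le> layer k t"
proof -
  have "(2::real) powr (real_of_int k - 1) \<le> 2 powr real_of_int k" by (intro powr_mono) auto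
  then show "s \<le> t \<Longrightarrow> layer k s \<le> layer k t" unfolding layer_def by linarith
qed

lemma sum_layer_interval:
  "(\<Sum>k\<in>{a..<a + int n}. layer k t) =
     min t (2 powr (real_of_int a + real n - 1)) - min t (2 powr (real_of_int a - 1))"
proof (induction n)
  case (Suc n)
  have "{a..<a + int (Suc n)} = insert (a + int n) {a..<a + int n}" by auto
  then show ?case using Suc by (simp add: layer_def algebra_simps)
qed simp

lemma sum_layer_diff_le:
  assumes "finite F" and st: "s \<le> t"
  shows "(\<Sum>k\<in>F. layer k t - layer k s) \<le> t - s"
proof (cases "F = {}")
  case False
  define a where "a = Min F"
  define n where "n = nat (Max F - Min F + 1)"
  have "Min F \<le> Max F" using assms(1) False by simp
  then have "F \<subseteq> {a..<a + int n}" using assms(1) Max_ge[OF assms(1)] by (fastforce simp: a_def n_def)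
  then have "(\<Sum>k\<in>F. layer k t - layer k s) \<le> (\<Sum>k\<in>{a..<a + int n}. layer k t - layer k s)"
    using layer_mono[OF st] by (intro sum_mono2) auto
  also have "\<dots> \<le> t - s"
    using st by (simp add: sum_subtractf sum_layer_interval)
  finally show ?thesis .
qed (use st in simp)

text \<open>For \<open>p \<ge> 1\<close> the sum of the \<open>p\<close>-th powers of the differences of the layers is at most the \<open>p\<close>-th
  power of their sum.  As the layers are all increasing in \<open>\<bar>u\<bar>\<close>, that sum telescopes to at most
  \<open>\<bar>u x - u y\<bar>\<close>.\<close>

lemma sum_layer_energy_le:
  fixes D :: "(real ^ 'n) set"
  assumes [measurable]: "u \<in> borel_measurable borel" "D \<in> sets borel"
    and F: "finite F" and p: "1 \<le> p"
  shows "(\<Sum>k\<in>F. frac_energy \<delta> p D (\<lambda>x. layer k \<bar>u x\<bar>)) \<le> frac_energy \<delta> p D u"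
proof -
  let ?s = "real CARD('n) + \<delta> * p"
  have [measurable]: "(\<lambda>x. layer k \<bar>u x\<bar>) \<in> borel_measurable borel" for k
    unfolding layer_def by measurable
  have pt: "(\<Sum>k\<in>F. \<bar>(layer k \<bar>u x\<bar>) - (layer k \<bar>u y\<bar>)\<bar> powr p) \<le> \<bar>u x - u y\<bar> powr p" for x y
  proof -
    have *: "(\<Sum>k\<in>F. \<bar>layer k a - layer k b\<bar>) \<le> \<bar>a - b\<bar>" if "b \<le> a" for a b
    proof -
      have "(\<Sum>k\<in>F. \<bar>layer k a - layer k b\<bar>) = (\<Sum>k\<in>F. layer k a - layer k b)"
        using layer_mono[OF that] by (intro sum.cong) auto
      also have "\<dots> \<le> \<bar>a - b\<bar>" using sum_layer_diff_le[OF F that] that by simp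
      finally show ?thesis .
    qed
    have **: "(\<Sum>k\<in>F. \<bar>layer k a - layer k b\<bar>) \<le> \<bar>a - b\<bar>" for a b
      using *[of a b] *[of b a] by (cases "b \<le> a") (auto simp: abs_minus_commute)
    have "(\<Sum>k\<in>F. \<bar>(layer k \<bar>u x\<bar>) - (layer k \<bar>u y\<bar>)\<bar> powr p) \<le> (\<Sum>k\<in>F. \<bar>(layer k \<bar>u x\<bar>) - (layer k \<bar>u y\<bar>)\<bar>) powr p"
      using p by (intro powr_sum_superadditive) auto
    also have "\<dots> \<le> \<bar>u x - u y\<bar> powr p"
      using p **[of "\<bar>u x\<bar>" "\<bar>u y\<bar>"] by (intro powr_mono2) (auto intro: sum_nonneg)
    finally show ?thesis .
  qed
  have "(\<Sum>k\<in>F. frac_energy \<delta> p D (\<lambda>x. layer k \<bar>u x\<bar>)) =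
     (\<integral>\<^sup>+x\<in>D. (\<integral>\<^sup>+y\<in>D. (\<Sum>k\<in>F. ennreal (\<bar>(layer k \<bar>u x\<bar>) - (layer k \<bar>u y\<bar>)\<bar> powr p / norm (x - y) powr ?s)) \<partial>lborel) \<partial>lborel)"
    unfolding frac_energy_def by (simp add: sum_distrib_right nn_integral_sum del: sum_ennreal)
  also have "\<dots> \<le> frac_energy \<delta> p D u"
    unfolding frac_energy_def
    by (intro nn_integral_mono mult_right_mono) 
       (auto simp: sum_divide_distrib[symmetric] intro!: ennreal_leI divide_right_mono pt)
  finally show ?thesis .
qed

text \<open>On the superlevel set the layer attains its full height \<open>2\<^sup>k - 2\<^sup>k\<^sup>-\<^sup>1 = 2\<^sup>k\<^sup>-\<^sup>1\<close>, so dividing it by this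
  height gives a competitor.\<close>

lemma frac_cap_superlevel_le:
  fixes D :: "(real ^ 'n) set"
  assumes "open D" and u: "u \<in> C0 D" "u \<in> borel_measurable borel"
  shows "frac_cap \<delta> p {x\<in>D. 2 powr real_of_int k \<le> \<bar>u x\<bar>} D
     \<le> ennreal (2 powr (- (real_of_int k - 1) * p)) * frac_energy \<delta> p D (\<lambda>x. layer k \<bar>u x\<bar>)"
proof -
  define c where "c = (2::real) powr - (real_of_int k - 1)"
  have c: "c > 0" by (simp add: c_def)
  have c2: "2 powr real_of_int k * c = 2" "2 powr (real_of_int k - 1) * c = 1"
    unfolding c_def by (simp_all flip: powr_add)
  have lt: "(2::real) powr (real_of_int k - 1) < 2 powr real_of_int k" by (intro powr_less_mono) auto
  have m: "(\<lambda>x. layer k \<bar>u x\<bar>) \<in> borel_measurable borel"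
    using u(2) unfolding layer_def by measurable
  have "frac_cap \<delta> p {x\<in>D. 2 powr real_of_int k \<le> \<bar>u x\<bar>} D \<le> frac_energy \<delta> p D (\<lambda>x. c * layer k \<bar>u x\<bar>)"
  proof (rule frac_cap_le)
    show "(\<lambda>x. c * layer k \<bar>u x\<bar>) \<in> C0 D"
      by (rule C0_compose[OF u(1), of "\<lambda>t. c * layer k \<bar>t\<bar>"])
         (auto simp: layer_def intro!: continuous_intros)
    fix x assume "x \<in> {x\<in>D. 2 powr real_of_int k \<le> \<bar>u x\<bar>}"
    then have layer_eq: "layer k \<bar>u x\<bar> = 2 powr real_of_int k - 2 powr (real_of_int k - 1)"
      using lt unfolding layer_def mem_Collect_eq by linarith
    then show "1 \<le> c * layer k \<bar>u x\<bar>"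
      unfolding layer_eq right_diff_distrib using c2 by (simp only: mult.commute[of c])
  qed
  also have "\<dots> = ennreal (c powr p) * frac_energy \<delta> p D (\<lambda>x. layer k \<bar>u x\<bar>)"
    using c m \<open>open D\<close> by (intro frac_energy_cmult) auto
  also have "c powr p = 2 powr (- (real_of_int k - 1) * p)"
    by (simp add: c_def powr_powr)
  finally show ?thesis .
qed

text \<open>Maz'ya's truncation argument for a general weight and a general countable covering: where
  \<open>2\<^sup>k \<le> \<bar>u\<bar> \<le> 2\<^sup>k\<^sup>+\<^sup>1\<close>, bound \<open>\<bar>u\<bar>\<^sup>q\<close> by \<open>2\<^sup>(\<^sup>k\<^sup>+\<^sup>1\<^sup>)\<^sup>q\<close>.  The \<open>r\<close>-th power of the capacity of
  \<open>A\<^sub>k\<close> carries the factor \<open>2\<^sup>-\<^sup>(\<^sup>k\<^sup>-\<^sup>1\<^sup>)\<^sup>p\<^sup>r = 2\<^sup>-\<^sup>(\<^sup>k\<^sup>-\<^sup>1\<^sup>)\<^sup>q\<close>, so that the dependence on \<open>k\<close> cancels up to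
  \<open>2\<^sup>2\<^sup>q\<close>.\<close>

lemma weighted_inequality_from_capacity:
  fixes D :: "(real ^ 'n) set" and w :: "real ^ 'n \<Rightarrow> ennreal"
  assumes "open D" and W: "countable W" "\<Union>W = D" "\<And>Q. Q \<in> W \<Longrightarrow> Q \<in> sets borel"
    and [measurable]: "w \<in> borel_measurable borel"
    and pq: "1 \<le> p" "p \<le> q" and c: "0 \<le> c" and N: "0 \<le> N"
    and local: "\<And>K Q. compact K \<Longrightarrow> K \<subseteq> D \<Longrightarrow> Q \<in> W \<Longrightarrow>
        (\<integral>\<^sup>+x\<in>K \<inter> Q. w x \<partial>lborel) \<le> ennreal c * ennpowr (frac_cap \<delta> p (K \<inter> Q) D) (q / p)"
    and cap: "\<And>K. compact K \<Longrightarrow> K \<subseteq> D \<Longrightarrow>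
        ennpowr (\<Sum>\<^sub>\<infinity>Q\<in>W. ennpowr (frac_cap \<delta> p (K \<inter> Q) D) (q / p)) (p / q) \<le> ennreal N * frac_cap \<delta> p K D"
    and u: "u \<in> C0 D" and um[measurable]: "u \<in> borel_measurable borel"
  shows "(\<integral>\<^sup>+x\<in>D. ennreal (\<bar>u x\<bar> powr q) * w x \<partial>lborel)
     \<le> ennreal (c * N powr (q / p) * 2 powr (2 * q)) * ennpowr (frac_energy \<delta> p D u) (q / p)"
proof -
  define r where "r = q / p"
  have r: "1 \<le> r" "0 < r" using pq by (simp_all add: r_def)
  define A where "A = (\<lambda>k::int. {x\<in>D. 2 powr real_of_int k \<le> \<bar>u x\<bar>})"
  define E where "E = (\<lambda>k. frac_energy \<delta> p D (\<lambda>x. layer k \<bar>u x\<bar>))"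
  have Dm [measurable]: "D \<in> sets borel" using \<open>open D\<close> by simp
  have Ac: "compact (A k)" "A k \<subseteq> D" for k
    unfolding A_def using u
    by (auto intro!: C0_superlevel_compact C0_compose[where f = abs] continuous_intros)
  have Am [measurable]: "A k \<in> sets borel" for k using Ac by (simp add: borel_compact)
  have level: "ennreal (2 powr ((real_of_int k + 1) * q)) * (\<integral>\<^sup>+x\<in>A k. w x \<partial>lborel)
      \<le> ennreal (c * N powr r * 2 powr (2 * q)) * ennpowr (E k) r" for k
  proof -
    let ?S = "\<Sum>\<^sub>\<infinity>Q\<in>W. ennpowr (frac_cap \<delta> p (A k \<inter> Q) D) r"
    have "(\<integral>\<^sup>+x\<in>A k. w x \<partial>lborel) \<le> (\<integral>\<^sup>+x. (\<integral>\<^sup>+Q. w x * indicator (A k \<inter> Q) x \<partial>count_space W) \<partial>lborel)"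
    proof (intro nn_integral_mono)
      fix x
      show "w x * indicator (A k) x \<le> (\<integral>\<^sup>+Q. w x * indicator (A k \<inter> Q) x \<partial>count_space W)"
      proof (cases "x \<in> A k")
        case True
        then obtain Q where Q: "Q \<in> W" "x \<in> Q" using Ac W(2) by blast
        then have "w x * indicator (A k) x \<le> w x * indicator (A k \<inter> Q) x"
          by (auto simp: indicator_def)
        also have "\<dots> \<le> (\<integral>\<^sup>+Q. w x * indicator (A k \<inter> Q) x \<partial>count_space W)"
          using Q(1) by (rule nn_integral_ge_point)
        finally show ?thesis .
      qed simp
    qed
    also have "\<dots> = (\<integral>\<^sup>+Q. (\<integral>\<^sup>+x\<in>A k \<inter> Q. w x \<partial>lborel) \<partial>count_space W)"
      using W by (intro nn_integral_count_space_nn_integral) auto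
    also have "\<dots> \<le> (\<integral>\<^sup>+Q. ennreal c * ennpowr (frac_cap \<delta> p (A k \<inter> Q) D) r \<partial>count_space W)"
      unfolding r_def using Ac by (intro nn_integral_mono local) auto
    also have "\<dots> = ennreal c * (\<integral>\<^sup>+Q. ennpowr (frac_cap \<delta> p (A k \<inter> Q) D) r \<partial>count_space W)"
      by (rule nn_integral_cmult) simp
    also have "\<dots> \<le> ennreal c * ?S"
      by (intro mult_left_mono nn_integral_count_space_le W finite_sum_le_infsum_ennreal) auto
    also have "?S \<le> ennreal (N powr r * 2 powr (- (real_of_int k - 1) * q)) * ennpowr (E k) r"
    proof -
      have "?S = ennpowr (ennpowr ?S (p / q)) r"
        using pq by (simp add: ennpowr_ennpowr r_def)
      also have "\<dots> \<le> ennpowr (ennreal N * frac_cap \<delta> p (A k) D) r"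
        unfolding r_def using pq Ac by (intro ennpowr_mono cap) auto
      also have "\<dots> \<le> ennpowr (ennreal N * (ennreal (2 powr (- (real_of_int k - 1) * p)) * E k)) r"
        unfolding A_def E_def using r \<open>open D\<close> u
        by (intro ennpowr_mono mult_left_mono frac_cap_superlevel_le um) auto
      also have "\<dots> = ennreal (N powr r * 2 powr (- (real_of_int k - 1) * q)) * ennpowr (E k) r"
        using r N pq by (simp add: ennpowr_mult ennpowr_ennreal powr_powr ennreal_mult mult.assoc)
                        (simp add: r_def)
      finally show ?thesis .
    qed
    finally have *: "(\<integral>\<^sup>+x\<in>A k. w x \<partial>lborel) \<le>
        ennreal c * (ennreal (N powr r * 2 powr (- (real_of_int k - 1) * q)) * ennpowr (E k) r)"
      by (simp add: mult_left_mono)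
    have "ennreal (2 powr ((real_of_int k + 1) * q)) * (\<integral>\<^sup>+x\<in>A k. w x \<partial>lborel) \<le>
        ennreal (2 powr ((real_of_int k + 1) * q)) *
          (ennreal c * (ennreal (N powr r * 2 powr (- (real_of_int k - 1) * q)) * ennpowr (E k) r))"
      using * by (rule mult_left_mono) simp
    also have "\<dots> = ennreal (2 powr ((real_of_int k + 1) * q) *
          (c * (N powr r * 2 powr (- (real_of_int k - 1) * q)))) * ennpowr (E k) r"
      using c by (simp add: ennreal_mult mult.assoc)
    also have "2 powr ((real_of_int k + 1) * q) * (c * (N powr r * 2 powr (- (real_of_int k - 1) * q)))
        = c * N powr r * 2 powr (2 * q)"
    proof -
      have "(2::real) powr ((real_of_int k + 1) * q) * 2 powr (- (real_of_int k - 1) * q) = 2 powr (2 * q)"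
        unfolding powr_add[symmetric] by (simp add: algebra_simps)
      then show ?thesis by (metis (no_types, lifting) mult.assoc mult.left_commute)
    qed
    finally show ?thesis .
  qed
  have "(\<integral>\<^sup>+x\<in>D. ennreal (\<bar>u x\<bar> powr q) * w x \<partial>lborel) \<le>
     (\<integral>\<^sup>+x. (\<integral>\<^sup>+k. ennreal (2 powr ((real_of_int k + 1) * q)) * (w x * indicator (A k) x) \<partial>count_space UNIV) \<partial>lborel)"
  proof (intro nn_integral_mono)
    fix x
    let ?f = "\<lambda>k::int. ennreal (2 powr ((real_of_int k + 1) * q)) * (w x * indicator (A k) x)"
    show "ennreal (\<bar>u x\<bar> powr q) * w x * indicator D x \<le> (\<integral>\<^sup>+k. ?f k \<partial>count_space UNIV)"
    proof (cases "x \<in> D \<and> u x \<noteq> 0")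
      case True
      define k where "k = \<lfloor>log 2 \<bar>u x\<bar>\<rfloor>"
      have lg: "real_of_int k \<le> log 2 \<bar>u x\<bar>" "log 2 \<bar>u x\<bar> \<le> real_of_int k + 1"
        unfolding k_def by linarith+
      then have k: "2 powr real_of_int k \<le> \<bar>u x\<bar>" "\<bar>u x\<bar> \<le> 2 powr (real_of_int k + 1)"
        using True by (simp_all add: le_log_iff log_le_iff)
      then have "\<bar>u x\<bar> powr q \<le> 2 powr ((real_of_int k + 1) * q)"
        using powr_mono2[of q "\<bar>u x\<bar>" "2 powr (real_of_int k + 1)"] pq by (simp add: powr_powr)
      then have "ennreal (\<bar>u x\<bar> powr q) * w x * indicator D x \<le> ?f k"
        using True k(1) by (auto simp: A_def intro!: mult_right_mono ennreal_leI)
      also have "\<dots> \<le> (\<integral>\<^sup>+k. ?f k \<partial>count_space UNIV)"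
        by (rule nn_integral_ge_point) simp
      finally show ?thesis .
    qed (use pq in auto)
  qed
  also have "\<dots> = (\<integral>\<^sup>+k. (\<integral>\<^sup>+x. ennreal (2 powr ((real_of_int k + 1) * q)) * (w x * indicator (A k) x) \<partial>lborel) \<partial>count_space UNIV)"
    by (intro nn_integral_count_space_nn_integral) auto
  also have "\<dots> = (\<integral>\<^sup>+k. ennreal (2 powr ((real_of_int k + 1) * q)) * (\<integral>\<^sup>+x\<in>A k. w x \<partial>lborel) \<partial>count_space UNIV)"
    by (simp add: nn_integral_cmult)
  also have "\<dots> \<le> (\<integral>\<^sup>+k. ennreal (c * N powr r * 2 powr (2 * q)) * ennpowr (E k) r \<partial>count_space UNIV)"
    by (intro nn_integral_mono level)
  also have "\<dots> = ennreal (c * N powr r * 2 powr (2 * q)) * (\<integral>\<^sup>+k. ennpowr (E k) r \<partial>count_space UNIV)"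
    by (rule nn_integral_cmult) simp
  also have "\<dots> \<le> ennreal (c * N powr r * 2 powr (2 * q)) * ennpowr (frac_energy \<delta> p D u) r"
  proof (intro mult_left_mono nn_integral_count_space_le)
    fix F :: "int set" assume F: "finite F"
    have "(\<Sum>k\<in>F. ennpowr (E k) r) \<le> ennpowr (\<Sum>k\<in>F. E k) r"
      using r(1) by (rule sum_ennpowr_le)
    also have "\<dots> \<le> ennpowr (frac_energy \<delta> p D u) r"
      unfolding E_def using F pq r by (intro ennpowr_mono sum_layer_energy_le) auto
    finally show "(\<Sum>k\<in>F. ennpowr (E k) r) \<le> ennpowr (frac_energy \<delta> p D u) r" .
  qed auto
  finally show ?thesis by (simp add: r_def)
qed

section \<open>Energy of functions cut off near a set\<close>

text \<open>Near the diagonal the integrand is of order \<open>\<bar>x - y\<bar>\<^sup>p\<^sup>-\<^sup>n\<^sup>-\<^sup>\<delta>\<^sup>p\<close>, integrable since \<open>\<delta> < 1\<close>; far away it is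
  \<open>\<bar>x - y\<bar>\<^sup>-\<^sup>n\<^sup>-\<^sup>\<delta>\<^sup>p\<close>, integrable since \<open>\<delta>p > 0\<close>.  Comparison with step functions on balls of radius
  \<open>2\<^sup>-\<^sup>j/L\<close> and \<open>2\<^sup>j\<^sup>+\<^sup>1/L\<close> reduces this to two geometric series, with the ratios \<open>\<rho>1\<close> and \<open>\<rho>2\<close>.\<close>

lemma truncated_kernel_integral_bound:
  fixes \<delta> p :: real
  assumes \<delta>: "0 < \<delta>" "\<delta> < 1" and p: "0 < p"
  obtains C where "0 < C"
    "\<And>L (x :: real ^ 'n). 0 < L \<Longrightarrow>
       (\<integral>\<^sup>+y. ennreal (min 1 (L * norm (x - y)) powr p / norm (x - y) powr (real CARD('n) + \<delta> * p)) \<partial>lborel)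
         \<le> ennreal (C * L powr (\<delta> * p))"
proof -
  let ?n = "real CARD('n)"
  define s where "s = ?n + \<delta> * p"
  define \<omega> where "\<omega> = unit_ball_vol ?n"
  have \<omega>: "\<omega> > 0" by (simp add: \<omega>_def)
  define \<rho>1 where "\<rho>1 = (2::real) powr (\<delta> * p - p)"
  define \<rho>2 where "\<rho>2 = (2::real) powr - (\<delta> * p)"
  have dp: "\<delta> * p < p" "0 < \<delta> * p" using \<delta> p by auto
  have \<rho>: "0 < \<rho>1" "\<rho>1 < 1" "0 < \<rho>2" "\<rho>2 < 1"
    using dp powr_less_mono[of "\<delta> * p - p" 0 2] powr_less_mono[of "- (\<delta> * p)" 0 2]
    by (auto simp: \<rho>1_def \<rho>2_def)
  define C where "C = \<omega> * (2 powr s * (1 / (1 - \<rho>1)) + 2 powr ?n * (1 / (1 - \<rho>2)))"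
  have C: "C > 0" using \<omega> \<rho> by (simp add: C_def add_pos_pos)
  show ?thesis
  proof (rule that[OF C])
    fix L :: real and x :: "real ^ 'n" assume L: "0 < L"
    define a where "a = (\<lambda>j::nat. L powr s * 2 powr (- real j * p + (real j + 1) * s))"
    define b where "b = (\<lambda>j::nat. L powr s * 2 powr (- real j * s))"
    define P where "P = (\<lambda>j::nat. cball x (2 powr - real j / L))"
    define R where "R = (\<lambda>j::nat. cball x (2 powr (real j + 1) / L))"
    define f where "f = (\<lambda>j y. ennreal (a j) * indicator (P j) y + ennreal (b j) * indicator (R j) y)"
    have [measurable]: "P j \<in> sets borel" "R j \<in> sets borel" for j
      by (simp_all add: P_def R_def)
    have [measurable]: "f j \<in> borel_measurable borel" for j
      unfolding f_def by measurable
    have pos: "0 \<le> a j" "0 \<le> b j" for j by (simp_all add: a_def b_def)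
    have pt: "ennreal (min 1 (L * norm (x - y)) powr p / norm (x - y) powr s) \<le> (\<Sum>j. f j y)" for y
    proof (cases "y = x")
      case False
      define t where "t = L * norm (x - y)"
      have t: "t > 0" using L False by (simp add: t_def)
      have nrm: "norm (x - y) = t / L" using L by (simp add: t_def)
      have "\<exists>j. ennreal (min 1 t powr p / norm (x - y) powr s) \<le> f j y"
      proof (cases "t \<le> 1")
        case True
        \<comment> \<open>The dyadic scale with \<open>2\<^sup>-\<^sup>(\<^sup>j\<^sup>+\<^sup>1\<^sup>) \<le> t \<le> 2\<^sup>-\<^sup>j\<close>.\<close>
        define j where "j = nat \<lfloor>- log 2 t\<rfloor>"
        have "log 2 t \<le> 0" using True t by (simp add: log_le_zero_cancel_iff)
        then have "real j \<le> - log 2 t" "- log 2 t < real j + 1"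
          unfolding j_def by linarith+
        then have tj: "t \<le> 2 powr - real j" "2 powr - (real j + 1) \<le> t"
          using t by (simp_all add: log_le_iff[symmetric] le_log_iff[symmetric])
        have "t powr p / norm (x - y) powr s = L powr s * (t powr p * t powr - s)"
          using t L by (simp add: nrm powr_divide powr_minus field_simps)
        also have "\<dots> \<le> L powr s * ((2 powr - real j) powr p * (2 powr - (real j + 1)) powr - s)"
          using tj t p dp
          by (intro mult_left_mono mult_mono powr_mono2 powr_mono2') (auto simp: s_def)
        also have "\<dots> = a j"
          by (simp add: a_def powr_powr powr_add algebra_simps flip: powr_add)
        finally have "ennreal (min 1 t powr p / norm (x - y) powr s) \<le> ennreal (a j)"
          using True by (simp add: ennreal_leI)
        moreover have "y \<in> P j"
          using tj(1) L by (simp add: P_def dist_norm nrm divide_right_mono)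
        ultimately show ?thesis by (intro exI[of _ j]) (auto simp: f_def intro: order_trans)
      next
        case False
        define j where "j = nat \<lfloor>log 2 t\<rfloor>"
        have "0 \<le> log 2 t" using False by simp
        then have "real j \<le> log 2 t" "log 2 t < real j + 1"
          unfolding j_def by linarith+
        then have tj: "2 powr real j \<le> t" "t \<le> 2 powr (real j + 1)"
          using t by (simp_all add: log_le_iff[symmetric] le_log_iff[symmetric])
        have "1 / norm (x - y) powr s = L powr s * t powr - s"
          using t L by (simp add: nrm powr_divide powr_minus field_simps)
        also have "\<dots> \<le> L powr s * (2 powr real j) powr - s"
          using tj t dp by (intro mult_left_mono powr_mono2') (auto simp: s_def)
        also have "\<dots> = b j" by (simp add: b_def powr_powr)
        finally have "ennreal (min 1 t powr p / norm (x - y) powr s) \<le> ennreal (b j)"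
          using False by (simp add: ennreal_leI)
        moreover have "y \<in> R j"
          using tj(2) L by (simp add: R_def dist_norm nrm divide_right_mono)
        ultimately show ?thesis by (intro exI[of _ j]) (auto simp: f_def intro: order_trans)
      qed
      then obtain j where "ennreal (min 1 t powr p / norm (x - y) powr s) \<le> f j y" ..
      also have "f j y \<le> (\<Sum>j. f j y)"
        using sum_le_suminf[of "\<lambda>j. f j y" "{j}"] by simp
      finally show ?thesis by (simp add: t_def)
    qed simp
    have vol: "emeasure lborel (cball x r) = ennreal (\<omega> * r powr ?n)" if "r > 0" for r
      using that by (simp add: emeasure_cball \<omega>_def powr_realpow)
    have Lcancel: "L powr s * (1 / L) powr ?n = L powr (\<delta> * p)"
      using L by (simp add: s_def powr_divide powr_add)
    have \<rho>1: "\<rho>1 ^ j = 2 powr ((\<delta> * p - p) * real j)" for j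
      by (simp add: \<rho>1_def powr_power mult.commute)
    have \<rho>2: "\<rho>2 ^ j = 2 powr (- (\<delta> * p) * real j)" for j
      by (simp add: \<rho>2_def powr_power mult.commute)
    have aP: "a j * (\<omega> * (2 powr - real j / L) powr ?n) = \<omega> * L powr (\<delta> * p) * (2 powr s * \<rho>1 ^ j)" for j
    proof -
      have e1: "(2 powr - real j / L) powr ?n = 2 powr (- real j * ?n) * (1 / L) powr ?n"
        using L by (simp add: powr_divide powr_powr)
      have "- real j * p + (real j + 1) * s + - real j * ?n = s + (\<delta> * p - p) * real j"
        by (simp add: s_def algebra_simps)
      then have e2: "2 powr (- real j * p + (real j + 1) * s) * 2 powr (- real j * ?n) = 2 powr s * \<rho>1 ^ j"
        unfolding \<rho>1 powr_add[symmetric] by (simp only:)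
      have "a j * (\<omega> * (2 powr - real j / L) powr ?n) = \<omega> * (L powr s * (1 / L) powr ?n)
          * (2 powr (- real j * p + (real j + 1) * s) * 2 powr (- real j * ?n))"
        unfolding a_def e1 by (simp only: mult_ac)
      then show ?thesis by (simp only: Lcancel e2)
    qed
    have bR: "b j * (\<omega> * (2 powr (real j + 1) / L) powr ?n) = \<omega> * L powr (\<delta> * p) * (2 powr ?n * \<rho>2 ^ j)" for j
    proof -
      have e1: "(2 powr (real j + 1) / L) powr ?n = 2 powr ((real j + 1) * ?n) * (1 / L) powr ?n"
        using L by (simp add: powr_divide powr_powr)
      have "- real j * s + (real j + 1) * ?n = ?n + - (\<delta> * p) * real j"
        by (simp add: s_def algebra_simps)
      then have e2: "2 powr (- real j * s) * 2 powr ((real j + 1) * ?n) = 2 powr ?n * \<rho>2 ^ j"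
        unfolding \<rho>2 powr_add[symmetric] by (simp only:)
      have "b j * (\<omega> * (2 powr (real j + 1) / L) powr ?n) = \<omega> * (L powr s * (1 / L) powr ?n)
          * (2 powr (- real j * s) * 2 powr ((real j + 1) * ?n))"
        unfolding b_def e1 by (simp only: mult_ac)
      then show ?thesis by (simp only: Lcancel e2)
    qed
    have int_f: "(\<integral>\<^sup>+y. f j y \<partial>lborel)
        = ennreal (\<omega> * L powr (\<delta> * p) * (2 powr s * \<rho>1 ^ j) + \<omega> * L powr (\<delta> * p) * (2 powr ?n * \<rho>2 ^ j))" for j
    proof -
      have "(\<integral>\<^sup>+y. f j y \<partial>lborel) = ennreal (a j) * emeasure lborel (P j) + ennreal (b j) * emeasure lborel (R j)"
        unfolding f_def by (subst nn_integral_add) (auto simp: nn_integral_cmult_indicator)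
      also have "\<dots> = ennreal (a j * (\<omega> * (2 powr - real j / L) powr ?n) + b j * (\<omega> * (2 powr (real j + 1) / L) powr ?n))"
        using L \<omega> pos[of j] by (simp add: P_def R_def vol ennreal_mult)
      finally show ?thesis by (simp only: aP bR)
    qed
    have "(\<integral>\<^sup>+y. ennreal (min 1 (L * norm (x - y)) powr p / norm (x - y) powr s) \<partial>lborel) \<le> (\<integral>\<^sup>+y. (\<Sum>j. f j y) \<partial>lborel)"
      by (intro nn_integral_mono pt)
    also have "\<dots> = (\<Sum>j. (\<integral>\<^sup>+y. f j y \<partial>lborel))"
      by (rule nn_integral_suminf) simp
    also have "\<dots> = ennreal (C * L powr (\<delta> * p))"
      unfolding int_f
    proof (rule suminf_ennreal_eq)
      have "(\<lambda>j. \<omega> * L powr (\<delta> * p) * (2 powr s * \<rho>1 ^ j) + \<omega> * L powr (\<delta> * p) * (2 powr ?n * \<rho>2 ^ j))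
        sums (\<omega> * L powr (\<delta> * p) * (2 powr s * (1 / (1 - \<rho>1))) + \<omega> * L powr (\<delta> * p) * (2 powr ?n * (1 / (1 - \<rho>2))))"
        using \<rho> by (intro sums_add sums_mult geometric_sums) auto
      then show "(\<lambda>j. \<omega> * L powr (\<delta> * p) * (2 powr s * \<rho>1 ^ j) + \<omega> * L powr (\<delta> * p) * (2 powr ?n * \<rho>2 ^ j))
        sums (C * L powr (\<delta> * p))"
        by (simp add: C_def algebra_simps)
    qed (use \<omega> \<rho> in simp)
    finally show "(\<integral>\<^sup>+y. ennreal (min 1 (L * norm (x - y)) powr p / norm (x - y) powr (?n + \<delta> * p)) \<partial>lborel)
         \<le> ennreal (C * L powr (\<delta> * p))"
      by (simp only: s_def)
  qed
qed

text \<open>The product rule \<open>v x - v y = \<phi> y (u x - u y) + u x (\<phi> x - \<phi> y)\<close> for \<open>v = \<phi>u\<close>, applied with \<open>x \<in> R\<close>.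
  By symmetry of the kernel it costs only the factor \<open>2\<close> to assume \<open>x \<in> R\<close>, and then the second
  term involves the values of \<open>u\<close> on \<open>R\<close> only.\<close>

lemma cutoff_energy_le:
  fixes D R :: "(real ^ 'n) set"
  assumes [measurable]: "D \<in> sets borel" "R \<in> sets borel" "u \<in> borel_measurable borel" "\<phi> \<in> borel_measurable borel"
    and p: "0 < p"
    and \<phi>: "\<And>x. 0 \<le> \<phi> x" "\<And>x. \<phi> x \<le> 1" "\<And>x y. \<bar>\<phi> x - \<phi> y\<bar> \<le> L * norm (x - y)" "\<And>x. x \<notin> R \<Longrightarrow> \<phi> x = 0"
    and C: "\<And>x :: real ^ 'n. (\<integral>\<^sup>+y. ennreal (min 1 (L * norm (x - y)) powr p / norm (x - y) powr (real CARD('n) + \<delta> * p)) \<partial>lborel) \<le> ennreal C"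
  shows "frac_energy \<delta> p D (\<lambda>x. \<phi> x * u x) \<le> ennreal (2 * 2 powr p) *
     ((\<integral>\<^sup>+x\<in>R. (\<integral>\<^sup>+y\<in>D. ennreal (\<bar>u x - u y\<bar> powr p / norm (x - y) powr (real CARD('n) + \<delta> * p)) \<partial>lborel) \<partial>lborel)
      + ennreal C * (\<integral>\<^sup>+x\<in>R. ennreal (\<bar>u x\<bar> powr p) \<partial>lborel))"
proof -
  let ?s = "real CARD('n) + \<delta> * p"
  define v where "v = (\<lambda>x. \<phi> x * u x)"
  have [measurable]: "v \<in> borel_measurable borel" unfolding v_def by measurable
  define h where "h = (\<lambda>x y. ennreal (\<bar>v x - v y\<bar> powr p / norm (x - y) powr ?s))"
  have [measurable]: "(\<lambda>(x, y). h x y) \<in> borel_measurable (borel \<Otimes>\<^sub>M borel)"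
    unfolding h_def by measurable
  define g where "g = (\<lambda>x. (\<integral>\<^sup>+y\<in>D. ennreal (\<bar>u x - u y\<bar> powr p / norm (x - y) powr ?s) \<partial>lborel))"
  have [measurable]: "g \<in> borel_measurable borel" unfolding g_def by measurable
  have hsym: "h x y = h y x" for x y
    by (simp add: h_def abs_minus_commute norm_minus_commute)
  have h0: "h x y = 0" if "x \<notin> R" "y \<notin> R" for x y
    using that p by (simp add: h_def v_def \<phi>)
  have half: "(\<integral>\<^sup>+x\<in>R. (\<integral>\<^sup>+y\<in>D. h x y \<partial>lborel) \<partial>lborel) \<le>
      ennreal (2 powr p) * ((\<integral>\<^sup>+x\<in>R. g x \<partial>lborel) + ennreal C * (\<integral>\<^sup>+x\<in>R. ennreal (\<bar>u x\<bar> powr p) \<partial>lborel))"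
  proof -
    have inner: "(\<integral>\<^sup>+y\<in>D. h x y \<partial>lborel) \<le> ennreal (2 powr p) * (g x + ennreal C * ennreal (\<bar>u x\<bar> powr p))" for x
    proof -
      let ?k = "\<lambda>y. ennreal (min 1 (L * norm (x - y)) powr p / norm (x - y) powr ?s)"
      have "h x y \<le> ennreal (2 powr p) * (ennreal (\<bar>u x - u y\<bar> powr p / norm (x - y) powr ?s) + ennreal (\<bar>u x\<bar> powr p) * ?k y)" for y
      proof -
        have "v x - v y = \<phi> y * (u x - u y) + u x * (\<phi> x - \<phi> y)"
          by (simp add: v_def algebra_simps)
        then have "\<bar>v x - v y\<bar> \<le> \<phi> y * \<bar>u x - u y\<bar> + \<bar>u x\<bar> * \<bar>\<phi> x - \<phi> y\<bar>"
          using abs_triangle_ineq[of "\<phi> y * (u x - u y)" "u x * (\<phi> x - \<phi> y)"] \<phi>(1) by (simp add: abs_mult)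
        also have "\<dots> \<le> 1 * \<bar>u x - u y\<bar> + \<bar>u x\<bar> * min 1 (L * norm (x - y))"
        proof -
          have "\<bar>\<phi> x - \<phi> y\<bar> \<le> 1" using \<phi>(1,2)[of x] \<phi>(1,2)[of y] by linarith
          then show ?thesis using \<phi>(2,3) by (intro add_mono mult_left_mono mult_right_mono) auto
        qed
        finally have "\<bar>v x - v y\<bar> powr p \<le> (\<bar>u x - u y\<bar> + \<bar>u x\<bar> * min 1 (L * norm (x - y))) powr p"
          using p by (intro powr_mono2) auto
        also have "\<dots> \<le> 2 powr p * (\<bar>u x - u y\<bar> powr p + (\<bar>u x\<bar> * min 1 (L * norm (x - y))) powr p)"
        proof (rule powr_add_le)
          have "0 \<le> L * norm (x - y)" using \<phi>(3)[of x y] by linarith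
          then show "0 \<le> \<bar>u x\<bar> * min 1 (L * norm (x - y))" by simp
        qed (use p in auto)
        also have "(\<bar>u x\<bar> * min 1 (L * norm (x - y))) powr p = \<bar>u x\<bar> powr p * min 1 (L * norm (x - y)) powr p"
        proof -
          have "0 \<le> L * norm (x - y)" using \<phi>(3)[of x y] by linarith
          then show ?thesis by (simp add: powr_mult)
        qed
        finally have "\<bar>v x - v y\<bar> powr p / norm (x - y) powr ?s \<le>
           2 powr p * (\<bar>u x - u y\<bar> powr p + \<bar>u x\<bar> powr p * min 1 (L * norm (x - y)) powr p) / norm (x - y) powr ?s"
          by (intro divide_right_mono) auto
        also have "\<dots> = 2 powr p * (\<bar>u x - u y\<bar> powr p / norm (x - y) powr ?s
             + \<bar>u x\<bar> powr p * (min 1 (L * norm (x - y)) powr p / norm (x - y) powr ?s))"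
          by (simp add: add_divide_distrib distrib_left)
        finally show ?thesis
          unfolding h_def by (simp add: ennreal_leI flip: ennreal_mult ennreal_plus)
      qed
      then have "(\<integral>\<^sup>+y\<in>D. h x y \<partial>lborel) \<le> (\<integral>\<^sup>+y. ennreal (2 powr p) *
         (ennreal (\<bar>u x - u y\<bar> powr p / norm (x - y) powr ?s) * indicator D y + ennreal (\<bar>u x\<bar> powr p) * ?k y) \<partial>lborel)"
        by (intro nn_integral_mono) (auto simp: indicator_def)
      also have "\<dots> = ennreal (2 powr p) * (g x + ennreal (\<bar>u x\<bar> powr p) * (\<integral>\<^sup>+y. ?k y \<partial>lborel))"
        by (simp add: nn_integral_cmult nn_integral_add g_def)
      also have "\<dots> \<le> ennreal (2 powr p) * (g x + ennreal (\<bar>u x\<bar> powr p) * ennreal C)"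
        by (intro mult_left_mono add_left_mono C) auto
      finally show ?thesis by (simp add: mult.commute[of "ennreal C"])
    qed
    have "(\<integral>\<^sup>+x\<in>R. (\<integral>\<^sup>+y\<in>D. h x y \<partial>lborel) \<partial>lborel) \<le>
       (\<integral>\<^sup>+x. ennreal (2 powr p) * (g x * indicator R x + ennreal C * (ennreal (\<bar>u x\<bar> powr p) * indicator R x)) \<partial>lborel)"
      using inner by (intro nn_integral_mono) (auto simp: indicator_def)
    also have "\<dots> = ennreal (2 powr p) * ((\<integral>\<^sup>+x\<in>R. g x \<partial>lborel) + ennreal C * (\<integral>\<^sup>+x\<in>R. ennreal (\<bar>u x\<bar> powr p) \<partial>lborel))"
      by (simp add: nn_integral_cmult nn_integral_add)
    finally show ?thesis .
  qed
  \<comment> \<open>The integrand vanishes unless \<open>x \<in> R\<close> or \<open>y \<in> R\<close>, and the two cases have equal integrals.\<close>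
  let ?I = "\<lambda>S T. \<integral>\<^sup>+x. (\<integral>\<^sup>+y. h x y * indicator S x * indicator T y \<partial>lborel) \<partial>lborel"
  have iter: "(\<integral>\<^sup>+y\<in>T. h x y \<partial>lborel) * indicator S x = (\<integral>\<^sup>+y. h x y * indicator S x * indicator T y \<partial>lborel)"
    for S T :: "(real ^ 'n) set" and x
    by (cases "x \<in> S") simp_all
  have "frac_energy \<delta> p D v = (\<integral>\<^sup>+x\<in>D. (\<integral>\<^sup>+y\<in>D. h x y \<partial>lborel) \<partial>lborel)"
    by (simp only: frac_energy_def h_def)
  also have "\<dots> = ?I D D" by (simp only: iter)
  also have "\<dots> \<le> (\<integral>\<^sup>+x. (\<integral>\<^sup>+y. h x y * indicator R x * indicator D y + h x y * indicator D x * indicator R y \<partial>lborel) \<partial>lborel)"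
    by (intro nn_integral_mono) (auto simp: indicator_def h0)
  also have "\<dots> = (\<integral>\<^sup>+x. (\<integral>\<^sup>+y. h x y * indicator R x * indicator D y \<partial>lborel)
      + (\<integral>\<^sup>+y. h x y * indicator D x * indicator R y \<partial>lborel) \<partial>lborel)"
    by (intro nn_integral_cong nn_integral_add) auto
  also have "\<dots> = ?I R D + ?I D R"
    by (intro nn_integral_add) auto
  also have "?I D R = (\<integral>\<^sup>+y. (\<integral>\<^sup>+x. h x y * indicator D x * indicator R y \<partial>lborel) \<partial>lborel)"
    by (rule lborel_pair.Fubini'[symmetric]) measurable
  also have "\<dots> = ?I R D"
    by (intro nn_integral_cong) (subst hsym, simp only: mult_ac)
  also have "?I R D = (\<integral>\<^sup>+x\<in>R. (\<integral>\<^sup>+y\<in>D. h x y \<partial>lborel) \<partial>lborel)"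
    by (simp only: iter)
  finally have "frac_energy \<delta> p D v \<le> 2 * (\<integral>\<^sup>+x\<in>R. (\<integral>\<^sup>+y\<in>D. h x y \<partial>lborel) \<partial>lborel)"
    by (simp add: mult_2)
  also have "\<dots> \<le> 2 * (ennreal (2 powr p) * ((\<integral>\<^sup>+x\<in>R. g x \<partial>lborel) + ennreal C * (\<integral>\<^sup>+x\<in>R. ennreal (\<bar>u x\<bar> powr p) \<partial>lborel)))"
    by (intro mult_left_mono half) auto
  finally show ?thesis
    by (simp add: v_def g_def ennreal_mult mult.assoc)
qed

text \<open>Jensen's inequality up to the factor \<open>2\<^sup>r\<close>.  For every \<open>t > 0\<close> we have \<open>f \<le> t + t\<^sup>1\<^sup>-\<^sup>rf\<^sup>r\<close> pointwise;
  integrate this over \<open>R\<close> with \<open>t\<close> equal to half of the mean of \<open>f\<close>, so that the first term absorbs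
  half of the left-hand side.\<close>

lemma nn_integral_powr_le:
  fixes f :: "'a \<Rightarrow> real"
  assumes [measurable]: "f \<in> borel_measurable M" "R \<in> sets M" and f: "\<And>x. 0 \<le> f x"
    and m: "emeasure M R = ennreal m" "0 < m" and r: "1 \<le> r"
  shows "ennpowr (\<integral>\<^sup>+x\<in>R. ennreal (f x) \<partial>M) r \<le> ennreal (2 powr r * m powr (r - 1)) * (\<integral>\<^sup>+x\<in>R. ennreal (f x powr r) \<partial>M)"
proof -
  let ?I = "\<integral>\<^sup>+x\<in>R. ennreal (f x) \<partial>M" and ?J = "\<integral>\<^sup>+x\<in>R. ennreal (f x powr r) \<partial>M"
  have cheb: "?I \<le> ennreal (t * m) + ennreal (t powr (1 - r)) * ?J" if t: "0 < t" for t
  proof -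
    have pt: "f x \<le> t + t powr (1 - r) * f x powr r" for x
    proof (cases "f x \<le> t")
      case False
      then have "t powr (r - 1) \<le> f x powr (r - 1)" using r t by (intro powr_mono2) auto
      then have "f x * (t powr (1 - r) * t powr (r - 1)) \<le> f x * (t powr (1 - r) * f x powr (r - 1))"
        using f by (intro mult_left_mono) auto
      moreover have "t powr (1 - r) * t powr (r - 1) = 1" using t by (simp flip: powr_add)
      moreover have "f x powr r = f x * f x powr (r - 1)" using f powr_mult_base[of "f x" "r - 1"] by simp
      ultimately show ?thesis using t by (simp add: mult_ac)
    qed (simp add: add_increasing2)
    have "?I \<le> (\<integral>\<^sup>+x. ennreal t * indicator R x + ennreal (t powr (1 - r)) * (ennreal (f x powr r) * indicator R x) \<partial>M)"
      using pt t by (intro nn_integral_mono)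
        (auto simp: indicator_def intro!: ennreal_leI simp flip: ennreal_mult ennreal_plus)
    also have "\<dots> = ennreal (t * m) + ennreal (t powr (1 - r)) * ?J"
      using t m by (simp add: nn_integral_add nn_integral_cmult nn_integral_cmult_indicator ennreal_mult)
    finally show ?thesis .
  qed
  show ?thesis
  proof (cases ?J)
    case top
    then show ?thesis using m by (simp add: ennreal_mult_top)
  next
    case J: (real j)
    have "?I \<le> ennreal m + ennreal j" using cheb[of 1] J by simp
    then obtain i where I: "?I = ennreal i" "0 \<le> i"
      by (cases ?I) (auto simp: top_unique simp flip: ennreal_plus)
    show ?thesis
    proof (cases "i = 0")
      case False
      then have i: "0 < i" using I by simp
      define t where "t = i / (2 * m)"
      have t: "t > 0" using i m by (simp add: t_def)
      have "ennreal i \<le> ennreal (t * m + t powr (1 - r) * j)"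
        using cheb[OF t] I J m t by (simp add: ennreal_mult)
      then have "i \<le> t * m + t powr (1 - r) * j"
        using J m t ennreal_le_iff[of "t * m + t powr (1 - r) * j" i] by simp
      then have "i / 2 \<le> t powr (1 - r) * j" using m by (simp add: t_def)
      then have "i / 2 * t powr (r - 1) \<le> t powr (1 - r) * j * t powr (r - 1)"
        by (intro mult_right_mono) auto
      also have "\<dots> = j" using t by (simp add: mult.commute mult.left_commute flip: powr_add)
      also have "i / 2 * t powr (r - 1) = (i / 2) powr r / m powr (r - 1)"
      proof -
        have "t powr (r - 1) = (i / 2) powr (r - 1) / m powr (r - 1)"
          using i m by (simp add: t_def flip: powr_divide)
        then show ?thesis using powr_mult_base[of "i / 2" "r - 1"] i by simp
      qed
      finally have "i powr r \<le> 2 powr r * m powr (r - 1) * j"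
        using m i by (simp add: powr_divide field_simps)
      then show ?thesis
        using I J by (simp add: ennpowr_ennreal ennreal_leI flip: ennreal_mult)
    qed (use I in simp)
  qed
qed

section \<open>Whitney cubes\<close>

text \<open>The geometry of one Whitney cube, in terms of its side length \<open>l\<close>.  The constants are generous:
  the diameter is between \<open>l\<close> and \<open>nl\<close>, and a point of the dilated cube differs from a point of the
  cube by less than \<open>2l\<close> in each coordinate, which gives \<open>2nl + 4nl\<close> for its distance to the
  boundary.\<close>

lemma whitney_cube:
  fixes D :: "(real ^ 'n) set"
  assumes D: "open D" "D \<noteq> {}" "D \<noteq> UNIV" and W: "whitney_decomposition D W" and Q: "Q \<in> W"
  obtains l where "0 < l" "compact Q" "Q \<subseteq> dilate_cube (9/8) Q" "dilate_cube (9/8) Q \<subseteq> D"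
    "dilate_cube (9/8) Q \<in> sets borel"
    "emeasure lborel (dilate_cube (9/8) Q) = ennreal ((9/8 * l) ^ CARD('n))"
    "\<And>x z. z \<in> Q \<Longrightarrow> dist x z < l / 16 \<Longrightarrow> x \<in> dilate_cube (9/8) Q"
    "\<And>x. x \<in> dilate_cube (9/8) Q \<Longrightarrow> infdist x (frontier D) \<le> 6 * real CARD('n) * l"
    "\<And>x. x \<in> Q \<Longrightarrow> l \<le> infdist x (frontier D)"
proof -
  let ?n = "real CARD('n)"
  have "dyadic_cube Q" using W Q by (auto simp: whitney_decomposition_def)
  then obtain k :: int and m :: "int ^ 'n" where
    Qeq0: "Q = cbox (\<chi> i. real_of_int (m $ i) * 2 powi k) (\<chi> i. (real_of_int (m $ i) + 1) * 2 powi k)"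
    by (auto simp: dyadic_cube_def)
  define l where "l = (2::real) powi k"
  have l: "l > 0" by (simp add: l_def)
  define a b where "a = (\<chi> i. real_of_int (m $ i) * l)" and "b = (\<chi> i. (real_of_int (m $ i) + 1) * l)"
  have Qeq: "Q = cbox a b" by (simp add: Qeq0 a_def b_def l_def)
  have ab: "b $ i = a $ i + l" for i by (simp add: a_def b_def algebra_simps)
  have "a \<in> cbox a b" using l by (simp add: mem_box_cart ab)
  then have ne: "cbox a b \<noteq> {}" by auto
  define R where "R = cbox (\<chi> i. a $ i - l / 16) (\<chi> i. b $ i + l / 16)"
  have R: "dilate_cube (9/8) Q = R"
  proof -
    have bounds: "interval_lowerbound Q = a" "interval_upperbound Q = b"
      using ne by (simp_all add: Qeq)
    have "dilate_cube (9/8) Q = (\<lambda>x. (9/8) *\<^sub>R x + (- (1/8) *\<^sub>R midpoint a b)) ` cbox a b"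
      unfolding dilate_cube_def Let_def bounds unfolding Qeq
      by (intro image_cong) (auto simp: vec_eq_iff algebra_simps)
    also have "\<dots> = cbox ((9/8) *\<^sub>R a + (- (1/8) *\<^sub>R midpoint a b)) ((9/8) *\<^sub>R b + (- (1/8) *\<^sub>R midpoint a b))"
      using ne by (subst image_affinity_cbox) simp
    also have "\<dots> = R"
      unfolding R_def by (intro arg_cong2[of _ _ _ _ cbox]) (auto simp: vec_eq_iff midpoint_def ab field_simps)
    finally show ?thesis .
  qed
  have "a \<in> R" using l by (simp add: R_def mem_box_cart ab)
  then have neR: "R \<noteq> {}" by auto
  have mR: "emeasure lborel R = ennreal ((9/8 * l) ^ CARD('n))"
  proof -
    have "measure lborel R = (\<Prod>i\<in>(UNIV :: 'n set). 9/8 * l)"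
      using neR unfolding R_def by (subst content_cbox_cart) (auto simp: ab)
    then have "measure lborel R = (9/8 * l) ^ CARD('n)" by simp
    moreover have "emeasure lborel R \<noteq> top" unfolding R_def by (simp add: emeasure_lborel_cbox_eq)
    ultimately show ?thesis by (simp add: emeasure_eq_ennreal_measure)
  qed
  have sub: "Q \<subseteq> R"
  proof
    fix x assume "x \<in> Q"
    then have "a $ i \<le> x $ i" "x $ i \<le> b $ i" for i by (simp_all add: Qeq mem_box_cart)
    then have "a $ i - l / 16 \<le> x $ i" "x $ i \<le> b $ i + l / 16" for i
      using l by (simp_all add: add_increasing2 diff_le_eq)
    then show "x \<in> R" by (simp add: R_def mem_box_cart)
  qed
  have near: "x \<in> R" if z: "z \<in> Q" "dist x z < l / 16" for x z
  proof -
    have "a $ i - l / 16 \<le> x $ i" "x $ i \<le> b $ i + l / 16" for i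
    proof -
      have "\<bar>x $ i - z $ i\<bar> < l / 16"
        using z(2) component_le_norm_cart[of "x - z" i] by (simp add: dist_norm)
      moreover have "a $ i \<le> z $ i" "z $ i \<le> b $ i" using z(1) by (simp_all add: Qeq mem_box_cart)
      ultimately show "a $ i - l / 16 \<le> x $ i" "x $ i \<le> b $ i + l / 16" by linarith+
    qed
    then show ?thesis by (simp add: R_def mem_box_cart)
  qed
  have "a \<bullet> i \<le> b \<bullet> i" if "i \<in> Basis" for i
    using that l by (auto simp: Basis_vec_def inner_axis ab)
  then have diam: "diameter Q = dist a b" unfolding Qeq by (intro diameter_cbox) auto
  have diam_le: "diameter Q \<le> ?n * l"
  proof -
    have "norm (b - a) \<le> (\<Sum>i\<in>UNIV. \<bar>(b - a) $ i\<bar>)" by (rule norm_le_l1_cart)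
    then show ?thesis using l by (simp add: diam dist_norm norm_minus_commute ab)
  qed
  have diam_ge: "l \<le> diameter Q"
    using component_le_norm_cart[of "b - a" undefined] l by (simp add: diam dist_norm norm_minus_commute ab)
  have fr: "frontier D \<noteq> {}" "closed (frontier D)"
    using D by (auto simp: frontier_eq_empty)
  have wh: "diameter Q \<le> setdist Q (frontier D)" "setdist Q (frontier D) \<le> 4 * diameter Q"
      "dilate_cube (9/8) Q \<subseteq> D"
    using W Q by (auto simp: whitney_decomposition_def)
  show ?thesis
  proof (rule that[OF l])
    show "compact Q" by (simp add: Qeq)
    show "dilate_cube (9/8) Q \<in> sets borel" by (simp add: R R_def)
    show "infdist x (frontier D) \<le> 6 * ?n * l" if x: "x \<in> dilate_cube (9/8) Q" for x
    proof -
      obtain z y where zy: "z \<in> Q" "y \<in> frontier D" "dist z y = setdist Q (frontier D)"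
        using setdist_compact_closed[of Q "frontier D"] fr ne by (auto simp: Qeq)
      have "\<bar>(x - z) $ i\<bar> \<le> 2 * l" for i
        using x zy(1) l ab[of i] unfolding R by (auto simp: R_def Qeq mem_box_cart dest!: spec[of _ i])
      then have "(\<Sum>i\<in>UNIV. \<bar>(x - z) $ i\<bar>) \<le> (\<Sum>i\<in>(UNIV :: 'n set). 2 * l)"
        by (intro sum_mono) auto
      then have "dist x z \<le> ?n * (2 * l)"
        using norm_le_l1_cart[of "x - z"] by (simp add: dist_norm)
      moreover have "dist z y \<le> 4 * (?n * l)" using zy(3) wh(2) diam_le by linarith
      moreover have "infdist x (frontier D) \<le> dist x y" using zy(2) by (rule infdist_le)
      ultimately show ?thesis using dist_triangle[of x y z] by (simp add: algebra_simps)
    qed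
    show "l \<le> infdist x (frontier D)" if x: "x \<in> Q" for x
    proof -
      obtain y where y: "y \<in> frontier D" "infdist x (frontier D) = dist x y"
        using infdist_attains_inf[OF fr(2,1)] by blast
      have "setdist Q (frontier D) \<le> dist x y" using x y(1) by (rule setdist_le_dist)
      then show ?thesis using y(2) wh(1) diam_ge by linarith
    qed
  qed (use mR sub near wh R in auto)
qed

lemma whitney_countable:
  fixes W :: "(real ^ 'n) set set"
  assumes "whitney_decomposition D W"
  shows "countable W"
proof -
  have "W \<subseteq> range (\<lambda>(k::int, m :: int ^ 'n).
      cbox (\<chi> i. real_of_int (m $ i) * 2 powi k) (\<chi> i. (real_of_int (m $ i) + 1) * 2 powi k))"
    using assms by (fastforce simp: whitney_decomposition_def dyadic_cube_def)
  then show ?thesis by (rule countable_subset) simp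
qed

lemma infdist_frontier_pos:
  fixes D :: "'a::euclidean_space set"
  assumes "open D" "D \<noteq> UNIV" "x \<in> D"
  shows "0 < infdist x (frontier D)"
proof -
  have "frontier D \<noteq> {}" using assms by (auto simp: frontier_eq_empty)
  moreover have "x \<notin> frontier D" using assms by (simp add: frontier_def interior_open)
  ultimately show ?thesis
    using in_closed_iff_infdist_zero[of "frontier D" x] infdist_nonneg[of x "frontier D"] by fastforce
qed

lemma sum_overlap_integral_le:
  fixes f :: "'a \<Rightarrow> ennreal"
  assumes F: "finite F" and [measurable]: "f \<in> borel_measurable M" "D \<in> sets M"
    and R: "\<And>Q. Q \<in> F \<Longrightarrow> R Q \<in> sets M" "\<And>Q. Q \<in> F \<Longrightarrow> R Q \<subseteq> D"
    and overlap: "\<And>x. card {Q\<in>F. x \<in> R Q} \<le> N"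
  shows "(\<Sum>Q\<in>F. (\<integral>\<^sup>+x\<in>R Q. f x \<partial>M)) \<le> of_nat N * (\<integral>\<^sup>+x\<in>D. f x \<partial>M)"
proof -
  have "(\<Sum>Q\<in>F. (\<integral>\<^sup>+x\<in>R Q. f x \<partial>M)) = (\<integral>\<^sup>+x. (\<Sum>Q\<in>F. f x * indicator (R Q) x) \<partial>M)"
    using R by (intro nn_integral_sum[symmetric]) auto
  also have "\<dots> \<le> (\<integral>\<^sup>+x. of_nat N * (f x * indicator D x) \<partial>M)"
  proof (intro nn_integral_mono)
    fix x
    show "(\<Sum>Q\<in>F. f x * indicator (R Q) x) \<le> of_nat N * (f x * indicator D x)"
    proof (cases "x \<in> D")
      case True
      have "(\<Sum>Q\<in>F. f x * indicator (R Q) x) = (\<Sum>Q\<in>{Q\<in>F. x \<in> R Q}. f x)"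
        using F by (intro sum.mono_neutral_cong_right) auto
      also have "\<dots> = of_nat (card {Q\<in>F. x \<in> R Q}) * f x" by simp
      also have "\<dots> \<le> of_nat N * f x" using overlap[of x] by (intro mult_right_mono) auto
      finally show ?thesis using True by simp
    next
      case False
      then have "\<And>Q. Q \<in> F \<Longrightarrow> x \<notin> R Q" using R by auto
      then show ?thesis by simp
    qed
  qed
  also have "\<dots> = of_nat N * (\<integral>\<^sup>+x\<in>D. f x \<partial>M)" by (rule nn_integral_cmult) simp
  finally show ?thesis .
qed

section \<open>From the Hardy inequality to capacities\<close>

definition frac_density :: "real \<Rightarrow> real \<Rightarrow> (real ^ 'n) set \<Rightarrow> (real ^ 'n \<Rightarrow> real) \<Rightarrow> real ^ 'n \<Rightarrow> ennreal" where
  "frac_density \<delta> p G u x =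
     (\<integral>\<^sup>+y\<in>G. ennreal (\<bar>u x - u y\<bar> powr p / norm (x - y) powr (real CARD('n) + \<delta> * p)) \<partial>lborel)"

text \<open>Cut off at distance \<open>l/16\<close> from \<open>Q\<close>, the thickness of the shell between \<open>Q\<close> and the dilated
  cube.  The powers of \<open>l\<close> cancel: \<open>l\<^sup>-\<^sup>\<delta>\<^sup>q\<close> from the slope of the cutoff, \<open>l\<^sup>n\<^sup>(\<^sup>r\<^sup>-\<^sup>1\<^sup>)\<close> from
  Jensen's inequality and \<open>l\<^sup>\<alpha>\<close> from inserting the weight.\<close>

lemma whitney_cube_capacity_le:
  fixes D :: "(real ^ 'n) set"
  assumes D: "open D" "D \<noteq> {}" "D \<noteq> UNIV" and W: "whitney_decomposition D W"
    and \<delta>: "0 < \<delta>" "\<delta> < 1" and pq: "1 \<le> p" "p \<le> q"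
    and \<alpha>: "\<alpha> = q * (\<delta> + real CARD('n) * (1/q - 1/p))" "0 \<le> \<alpha>"
  obtains c where "0 < c"
    "\<And>Q u K. Q \<in> W \<Longrightarrow> u \<in> C0 D \<Longrightarrow> u \<in> borel_measurable borel \<Longrightarrow> (\<And>x. x \<in> K \<Longrightarrow> 1 \<le> u x) \<Longrightarrow>
       ennpowr (frac_cap \<delta> p (K \<inter> Q) D) (q / p) \<le> ennreal c *
         (ennpowr (\<integral>\<^sup>+x\<in>dilate_cube (9/8) Q. frac_density \<delta> p D u x \<partial>lborel) (q / p)
          + (\<integral>\<^sup>+x\<in>dilate_cube (9/8) Q. ennreal (\<bar>u x\<bar> powr q / infdist x (frontier D) powr \<alpha>) \<partial>lborel))"
proof -
  let ?n = "real CARD('n)"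
  define r where "r = q / p"
  have r: "1 \<le> r" "0 < r" "p * r = q" using pq by (auto simp: r_def)
  have p: "0 < p" using pq by simp
  obtain C where C: "0 < C"
    "\<And>L (x :: real ^ 'n). 0 < L \<Longrightarrow>
       (\<integral>\<^sup>+y. ennreal (min 1 (L * norm (x - y)) powr p / norm (x - y) powr (?n + \<delta> * p)) \<partial>lborel)
         \<le> ennreal (C * L powr (\<delta> * p))"
    by (rule truncated_kernel_integral_bound[where 'n = 'n, OF \<delta> p]) blast
  define c1 where "c1 = (C * 16 powr (\<delta> * p)) powr r * (2 powr r * (9/8) powr (?n * (r - 1)) * (6 * ?n) powr \<alpha>)"
  define c where "c = (2 * 2 powr p) powr r * 2 powr r * (1 + c1)"
  have c1: "c1 > 0" using C by (simp add: c1_def)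
  then have c: "c > 0" by (simp add: c_def)
  show ?thesis
  proof (rule that[OF c])
    fix Q K :: "(real ^ 'n) set" and u :: "real ^ 'n \<Rightarrow> real"
    assume Q: "Q \<in> W" and u: "u \<in> C0 D" and [measurable]: "u \<in> borel_measurable borel"
      and K: "\<And>x. x \<in> K \<Longrightarrow> 1 \<le> u x"
    define R where "R = dilate_cube (9/8) Q"
    obtain l where l: "0 < l" and Qc: "compact Q" and RD: "R \<subseteq> D" and Rm [measurable]: "R \<in> sets borel"
      and Re: "emeasure lborel R = ennreal ((9/8 * l) ^ CARD('n))"
      and near: "\<And>x z. z \<in> Q \<Longrightarrow> dist x z < l / 16 \<Longrightarrow> x \<in> R"
      and far: "\<And>x. x \<in> R \<Longrightarrow> infdist x (frontier D) \<le> 6 * ?n * l"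
      unfolding R_def by (rule whitney_cube[OF D W Q]) blast
    define G where "G = (\<integral>\<^sup>+x\<in>R. frac_density \<delta> p D u x \<partial>lborel)"
    define U where "U = (\<integral>\<^sup>+x\<in>R. ennreal (\<bar>u x\<bar> powr p) \<partial>lborel)"
    define V where "V = (\<integral>\<^sup>+x\<in>R. ennreal (\<bar>u x\<bar> powr q / infdist x (frontier D) powr \<alpha>) \<partial>lborel)"
    define L where "L = 16 / l"
    have L: "L > 0" using l by (simp add: L_def)
    have Dm [measurable]: "D \<in> sets borel" using D by simp
    have [measurable]: "(\<lambda>x. infdist x (frontier D)) \<in> borel_measurable borel"
      by (intro borel_measurable_continuous_onI continuous_intros)
    have "frac_cap \<delta> p (K \<inter> Q) D \<le> ennreal (2 * 2 powr p) * (G + ennreal (C * L powr (\<delta> * p)) * U)"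
    proof (cases "Q = {}")
      case True
      have "frac_cap \<delta> p (K \<inter> Q) D \<le> frac_energy \<delta> p D (\<lambda>x. 0)"
        using True by (intro frac_cap_le) (auto simp: C0_def)
      then show ?thesis using pq by (simp add: frac_energy_def)
    next
      case False
      define \<phi> where "\<phi> = (\<lambda>x. max 0 (1 - L * infdist x Q))"
      have cont: "continuous_on UNIV \<phi>" unfolding \<phi>_def by (intro continuous_intros)
      then have [measurable]: "\<phi> \<in> borel_measurable borel" by (rule borel_measurable_continuous_onI)
      have "frac_cap \<delta> p (K \<inter> Q) D \<le> frac_energy \<delta> p D (\<lambda>x. \<phi> x * u x)"
      proof (rule frac_cap_le)
        show "(\<lambda>x. \<phi> x * u x) \<in> C0 D"
          using u by (intro C0_subset[OF u] continuous_on_mult continuous_on_subset[OF cont]) (auto simp: C0_def)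
        fix x assume x: "x \<in> K \<inter> Q"
        then have "\<phi> x = 1" by (simp add: \<phi>_def)
        then show "1 \<le> \<phi> x * u x" using K x by simp
      qed
      also have "\<dots> \<le> ennreal (2 * 2 powr p) *
         ((\<integral>\<^sup>+x\<in>R. (\<integral>\<^sup>+y\<in>D. ennreal (\<bar>u x - u y\<bar> powr p / norm (x - y) powr (?n + \<delta> * p)) \<partial>lborel) \<partial>lborel)
          + ennreal (C * L powr (\<delta> * p)) * (\<integral>\<^sup>+x\<in>R. ennreal (\<bar>u x\<bar> powr p) \<partial>lborel))"
      proof (rule cutoff_energy_le)
        show "0 \<le> \<phi> x" "\<phi> x \<le> 1" for x
          using L infdist_nonneg[of x Q] by (auto simp: \<phi>_def)
        show "\<bar>\<phi> x - \<phi> y\<bar> \<le> L * norm (x - y)" for x y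
        proof -
          have "\<bar>\<phi> x - \<phi> y\<bar> \<le> \<bar>L * infdist x Q - L * infdist y Q\<bar>" unfolding \<phi>_def by linarith
          also have "\<dots> = L * \<bar>infdist x Q - infdist y Q\<bar>"
            using L by (simp add: abs_mult flip: right_diff_distrib)
          also have "\<dots> \<le> L * norm (x - y)"
            using L infdist_triangle_abs[of x Q y] by (simp add: dist_norm)
          finally show ?thesis .
        qed
        show "\<phi> x = 0" if "x \<notin> R" for x
        proof (rule ccontr)
          assume "\<phi> x \<noteq> 0"
          then have "L * infdist x Q < 1" by (simp add: \<phi>_def split: if_splits)
          then have lt: "infdist x Q < l / 16" using l by (simp add: L_def field_simps)
          obtain z where "z \<in> Q" "infdist x Q = dist x z"
            using infdist_attains_inf[of Q x] Qc False by (auto simp: compact_imp_closed)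
          then show False using near lt that by metis
        qed
      qed (use pq C(2)[OF L] in auto)
      finally show ?thesis by (simp only: G_def U_def frac_density_def)
    qed
    then have "ennpowr (frac_cap \<delta> p (K \<inter> Q) D) r \<le> ennpowr (ennreal (2 * 2 powr p) * (G + ennreal (C * L powr (\<delta> * p)) * U)) r"
      using r by (intro ennpowr_mono)
    also have "\<dots> = ennreal ((2 * 2 powr p) powr r) * ennpowr (G + ennreal (C * L powr (\<delta> * p)) * U) r"
      using r by (subst ennpowr_mult) (auto simp: ennpowr_ennreal)
    also have "\<dots> \<le> ennreal ((2 * 2 powr p) powr r) * (ennreal (2 powr r) *
        (ennpowr G r + ennpowr (ennreal (C * L powr (\<delta> * p)) * U) r))"
      using r by (intro mult_left_mono ennpowr_add_le) auto
    also have "ennpowr (ennreal (C * L powr (\<delta> * p)) * U) r \<le> ennreal c1 * V"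
    proof -
      define m where "m = (9/8 * l) powr ?n"
      have m: "m > 0" "emeasure lborel R = ennreal m"
        using l Re by (auto simp: m_def powr_realpow)
      have "ennpowr U r \<le> ennreal (2 powr r * m powr (r - 1)) * (\<integral>\<^sup>+x\<in>R. ennreal ((\<bar>u x\<bar> powr p) powr r) \<partial>lborel)"
        unfolding U_def using m r by (intro nn_integral_powr_le) auto
      also have "(\<integral>\<^sup>+x\<in>R. ennreal ((\<bar>u x\<bar> powr p) powr r) \<partial>lborel) = (\<integral>\<^sup>+x\<in>R. ennreal (\<bar>u x\<bar> powr q) \<partial>lborel)"
        using r by (simp add: powr_powr)
      also have "\<dots> \<le> ennreal ((6 * ?n * l) powr \<alpha>) * V"
      proof -
        have "(\<integral>\<^sup>+x\<in>R. ennreal (\<bar>u x\<bar> powr q) \<partial>lborel) \<le> (\<integral>\<^sup>+x. ennreal ((6 * ?n * l) powr \<alpha>) *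
             (ennreal (\<bar>u x\<bar> powr q / infdist x (frontier D) powr \<alpha>) * indicator R x) \<partial>lborel)"
        proof (intro nn_integral_mono)
          fix x
          show "ennreal (\<bar>u x\<bar> powr q) * indicator R x \<le> ennreal ((6 * ?n * l) powr \<alpha>) *
             (ennreal (\<bar>u x\<bar> powr q / infdist x (frontier D) powr \<alpha>) * indicator R x)"
          proof (cases "x \<in> R")
            case True
            define d where "d = infdist x (frontier D)"
            have d: "d > 0" "d \<le> 6 * ?n * l"
              using infdist_frontier_pos[of D x] True RD far D by (auto simp: d_def)
            have "\<bar>u x\<bar> powr q = d powr \<alpha> * (\<bar>u x\<bar> powr q / d powr \<alpha>)" using d by simp
            also have "\<dots> \<le> (6 * ?n * l) powr \<alpha> * (\<bar>u x\<bar> powr q / d powr \<alpha>)"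
              using d \<alpha>(2) by (intro mult_right_mono powr_mono2) auto
            finally show ?thesis
              using True by (simp add: d_def ennreal_leI flip: ennreal_mult)
          qed simp
        qed
        also have "\<dots> = ennreal ((6 * ?n * l) powr \<alpha>) * V"
          unfolding V_def by (rule nn_integral_cmult) simp
        finally show ?thesis .
      qed
      finally have Ur: "ennpowr U r \<le> ennreal (2 powr r * m powr (r - 1)) * (ennreal ((6 * ?n * l) powr \<alpha>) * V)"
        by (simp add: mult_left_mono)
      have "ennpowr (ennreal (C * L powr (\<delta> * p)) * U) r = ennreal ((C * L powr (\<delta> * p)) powr r) * ennpowr U r"
        using r C by (simp add: ennpowr_mult ennpowr_ennreal)
      also have "\<dots> \<le> ennreal ((C * L powr (\<delta> * p)) powr r) *
          (ennreal (2 powr r * m powr (r - 1)) * (ennreal ((6 * ?n * l) powr \<alpha>) * V))"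
        using Ur by (rule mult_left_mono) simp
      also have "\<dots> = ennreal ((C * L powr (\<delta> * p)) powr r * (2 powr r * m powr (r - 1) * (6 * ?n * l) powr \<alpha>)) * V"
        by (simp add: ennreal_mult mult.assoc)
      also have "(C * L powr (\<delta> * p)) powr r * (2 powr r * m powr (r - 1) * (6 * ?n * l) powr \<alpha>) = c1"
      proof -
        have "L powr (\<delta> * p) = 16 powr (\<delta> * p) * l powr - (\<delta> * p)"
          using l by (simp add: L_def powr_divide powr_minus_divide)
        then have e1: "(C * L powr (\<delta> * p)) powr r = (C * 16 powr (\<delta> * p)) powr r * l powr - (\<delta> * q)"
          using C l r(3) by (simp add: powr_mult powr_powr mult.assoc)
        have e2: "m powr (r - 1) = (9/8) powr (?n * (r - 1)) * l powr (?n * (r - 1))"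
          using l unfolding m_def powr_powr by (simp only: powr_mult)
        have e3: "(6 * ?n * l) powr \<alpha> = (6 * ?n) powr \<alpha> * l powr \<alpha>"
          using l by (simp only: powr_mult)
        have "- (\<delta> * q) + ?n * (r - 1) + \<alpha> = 0"
          using pq by (simp add: \<alpha>(1) r_def field_simps)
        then have e4: "l powr - (\<delta> * q) * l powr (?n * (r - 1)) * l powr \<alpha> = 1"
          using l by (simp flip: powr_add)
        have "(C * L powr (\<delta> * p)) powr r * (2 powr r * m powr (r - 1) * (6 * ?n * l) powr \<alpha>)
           = c1 * (l powr - (\<delta> * q) * l powr (?n * (r - 1)) * l powr \<alpha>)"
          unfolding e1 e2 e3 c1_def by (simp only: mult_ac)
        then show ?thesis by (simp only: e4 mult_1_right)
      qed
      finally show ?thesis .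
    qed
    also have "ennpowr G r + ennreal c1 * V \<le> ennreal (1 + c1) * (ennpowr G r + V)"
    proof -
      have "ennpowr G r + ennreal c1 * V \<le> ennreal (1 + c1) * ennpowr G r + ennreal (1 + c1) * V"
      proof (intro add_mono mult_right_mono ennreal_leI)
        have "1 * ennpowr G r \<le> ennreal (1 + c1) * ennpowr G r"
          using c1 by (intro mult_right_mono) (auto simp flip: ennreal_1 intro!: ennreal_leI)
        then show "ennpowr G r \<le> ennreal (1 + c1) * ennpowr G r" by simp
      qed auto
      then show ?thesis by (simp add: distrib_left)
    qed
    finally have "ennpowr (frac_cap \<delta> p (K \<inter> Q) D) r \<le>
        ennreal ((2 * 2 powr p) powr r) * (ennreal (2 powr r) * (ennreal (1 + c1) * (ennpowr G r + V)))"
      by (simp add: mult_left_mono add_left_mono)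
    also have "\<dots> = ennreal c * (ennpowr G r + V)"
      using c1 by (simp add: c_def ennreal_mult mult.assoc del: ennreal_plus)
    finally show "ennpowr (frac_cap \<delta> p (K \<inter> Q) D) (q / p) \<le> ennreal c *
         (ennpowr (\<integral>\<^sup>+x\<in>dilate_cube (9/8) Q. frac_density \<delta> p D u x \<partial>lborel) (q / p)
          + (\<integral>\<^sup>+x\<in>dilate_cube (9/8) Q. ennreal (\<bar>u x\<bar> powr q / infdist x (frontier D) powr \<alpha>) \<partial>lborel))"
      by (simp only: r_def G_def V_def R_def)
  qed
qed

text \<open>Sum the bound for a single cube over finitely many cubes, and use bounded overlap together with
  superadditivity of \<open>t \<mapsto> t\<^sup>r\<close> for the energy part and the Hardy inequality for the weighted part.\<close>

lemma capacity_sum_from_hardy: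
  fixes D :: "(real ^ 'n) set"
  assumes D: "open D" "D \<noteq> {}" "D \<noteq> UNIV" and W: "whitney_decomposition D W"
    and \<delta>: "0 < \<delta>" "\<delta> < 1" and pq: "1 \<le> p" "p \<le> q"
    and \<alpha>: "0 \<le> q * (\<delta> + real CARD('n) * (1/q - 1/p))"
    and hardy: "frac_hardy \<delta> q p D"
  obtains N where "0 < N" "\<And>K. K \<subseteq> D \<Longrightarrow>
       ennpowr (\<Sum>\<^sub>\<infinity>Q\<in>W. ennpowr (frac_cap \<delta> p (K \<inter> Q) D) (q / p)) (p / q) \<le> ennreal N * frac_cap \<delta> p K D"
proof -
  define \<alpha> where "\<alpha> = q * (\<delta> + real CARD('n) * (1/q - 1/p))"
  define r where "r = q / p"
  have r: "1 \<le> r" "0 < r" using pq by (auto simp: r_def)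
  define V where "V = (\<lambda>u x. ennreal (\<bar>u x\<bar> powr q / infdist x (frontier D) powr \<alpha>))"
  obtain H where H: "0 < H" "\<And>u. u \<in> C0 D \<Longrightarrow>
      (\<integral>\<^sup>+x\<in>D. V u x \<partial>lborel) \<le> ennreal H * ennpowr (frac_energy \<delta> p D u) r"
    using hardy unfolding frac_hardy_def V_def \<alpha>_def r_def by blast
  obtain M where M: "\<And>x. finite {Q\<in>W. x \<in> dilate_cube (9/8) Q}" "\<And>x. card {Q\<in>W. x \<in> dilate_cube (9/8) Q} \<le> M"
    using W unfolding whitney_decomposition_def by blast
  obtain c where c: "0 < c"
    "\<And>Q u K. Q \<in> W \<Longrightarrow> u \<in> C0 D \<Longrightarrow> u \<in> borel_measurable borel \<Longrightarrow> (\<And>x. x \<in> K \<Longrightarrow> 1 \<le> u x) \<Longrightarrow>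
       ennpowr (frac_cap \<delta> p (K \<inter> Q) D) r \<le> ennreal c *
         (ennpowr (\<integral>\<^sup>+x\<in>dilate_cube (9/8) Q. frac_density \<delta> p D u x \<partial>lborel) r
          + (\<integral>\<^sup>+x\<in>dilate_cube (9/8) Q. V u x \<partial>lborel))"
    unfolding r_def V_def
    by (rule whitney_cube_capacity_le[OF D W \<delta> pq \<alpha>_def]) (use \<alpha> in \<open>auto simp: \<alpha>_def\<close>)
  \<comment> \<open>The successor only ensures that the final constant is positive.\<close>
  define M' where "M' = Suc M"
  define B where "B = c * (real M' powr r + real M' * H)"
  have B: "B > 0" using c H by (simp add: B_def M'_def add_pos_pos)
  have [measurable]: "(\<lambda>x. infdist x (frontier D)) \<in> borel_measurable borel"
    by (intro borel_measurable_continuous_onI continuous_intros)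
  have Dm [measurable]: "D \<in> sets borel" using D by simp
  have Rm: "dilate_cube (9/8) Q \<in> sets borel" "dilate_cube (9/8) Q \<subseteq> D" if "Q \<in> W" for Q
    using that by (rule whitney_cube[OF D W]; simp)+
  have main: "ennpowr (\<Sum>\<^sub>\<infinity>Q\<in>W. ennpowr (frac_cap \<delta> p (K \<inter> Q) D) r) (p / q) \<le> ennreal (B powr (p / q)) * frac_energy \<delta> p D u"
    if u: "u \<in> C0 D" and um [measurable]: "u \<in> borel_measurable borel"
      and uK: "\<And>x. x \<in> K \<Longrightarrow> 1 \<le> u x" for K u
  proof -
    define E where "E = frac_energy \<delta> p D u"
    have [measurable]: "frac_density \<delta> p D u \<in> borel_measurable borel"
      unfolding frac_density_def by measurable
    have [measurable]: "V u \<in> borel_measurable borel" unfolding V_def by measurable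
    have "(\<Sum>\<^sub>\<infinity>Q\<in>W. ennpowr (frac_cap \<delta> p (K \<inter> Q) D) r) \<le> ennreal B * ennpowr E r"
    proof (rule infsum_le_ennreal)
      fix F assume F: "finite F" "F \<subseteq> W"
      have ov: "card {Q\<in>F. x \<in> dilate_cube (9/8) Q} \<le> M'" for x
      proof -
        have "card {Q\<in>F. x \<in> dilate_cube (9/8) Q} \<le> card {Q\<in>W. x \<in> dilate_cube (9/8) Q}"
          using F M(1) by (intro card_mono) auto
        then show ?thesis using M(2)[of x] by (simp add: M'_def)
      qed
      let ?G = "\<lambda>Q. \<integral>\<^sup>+x\<in>dilate_cube (9/8) Q. frac_density \<delta> p D u x \<partial>lborel"
      have "(\<Sum>Q\<in>F. ennpowr (frac_cap \<delta> p (K \<inter> Q) D) r) \<le>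
          (\<Sum>Q\<in>F. ennreal c * (ennpowr (?G Q) r + (\<integral>\<^sup>+x\<in>dilate_cube (9/8) Q. V u x \<partial>lborel)))"
        using F u um uK by (intro sum_mono c(2)) auto
      also have "\<dots> = ennreal c * ((\<Sum>Q\<in>F. ennpowr (?G Q) r) + (\<Sum>Q\<in>F. (\<integral>\<^sup>+x\<in>dilate_cube (9/8) Q. V u x \<partial>lborel)))"
        by (simp add: sum_distrib_left[symmetric] sum.distrib)
      also have "\<dots> \<le> ennreal c * (ennreal (real M' powr r) * ennpowr E r + ennreal (real M' * H) * ennpowr E r)"
      proof (intro mult_left_mono add_mono)
        have "(\<Sum>Q\<in>F. ennpowr (?G Q) r) \<le> ennpowr (\<Sum>Q\<in>F. ?G Q) r"
          using r by (intro sum_ennpowr_le)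
        also have "\<dots> \<le> ennpowr (of_nat M' * (\<integral>\<^sup>+x\<in>D. frac_density \<delta> p D u x \<partial>lborel)) r"
          using F Rm ov r by (intro ennpowr_mono sum_overlap_integral_le) auto
        also have "(\<integral>\<^sup>+x\<in>D. frac_density \<delta> p D u x \<partial>lborel) = E"
          by (simp only: frac_density_def E_def frac_energy_def)
        also have "ennpowr (of_nat M' * E) r = ennreal (real M' powr r) * ennpowr E r"
          using r by (simp add: ennpowr_mult ennpowr_ennreal flip: ennreal_of_nat_eq_real_of_nat)
                     (simp add: ennpowr_ennreal ennreal_of_nat_eq_real_of_nat)
        finally show "(\<Sum>Q\<in>F. ennpowr (?G Q) r) \<le> ennreal (real M' powr r) * ennpowr E r" .
        have "(\<Sum>Q\<in>F. (\<integral>\<^sup>+x\<in>dilate_cube (9/8) Q. V u x \<partial>lborel)) \<le> of_nat M' * (\<integral>\<^sup>+x\<in>D. V u x \<partial>lborel)"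
          using F Rm ov by (intro sum_overlap_integral_le) auto
        also have "\<dots> \<le> of_nat M' * (ennreal H * ennpowr E r)"
          unfolding E_def by (intro mult_left_mono H u) auto
        also have "\<dots> = ennreal (real M' * H) * ennpowr E r"
          using H(1) by (simp add: ennreal_mult ennreal_of_nat_eq_real_of_nat mult.assoc)
        finally show "(\<Sum>Q\<in>F. (\<integral>\<^sup>+x\<in>dilate_cube (9/8) Q. V u x \<partial>lborel)) \<le> ennreal (real M' * H) * ennpowr E r" .
      qed auto
      also have "\<dots> = ennreal B * ennpowr E r"
        using c H by (simp add: B_def ennreal_mult ennreal_plus distrib_left distrib_right mult.assoc)
      finally show "(\<Sum>Q\<in>F. ennpowr (frac_cap \<delta> p (K \<inter> Q) D) r) \<le> ennreal B * ennpowr E r" .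
    qed
    then have "ennpowr (\<Sum>\<^sub>\<infinity>Q\<in>W. ennpowr (frac_cap \<delta> p (K \<inter> Q) D) r) (p / q) \<le> ennpowr (ennreal B * ennpowr E r) (p / q)"
      using pq by (intro ennpowr_mono) auto
    also have "\<dots> = ennreal (B powr (p / q)) * E"
      using pq B by (simp add: ennpowr_mult ennpowr_ennreal ennpowr_ennpowr r_def)
    finally show ?thesis by (simp only: E_def)
  qed
  show ?thesis
  proof (rule that[of "B powr (p / q)"])
    show "0 < B powr (p / q)" using B by simp
    fix K assume K: "K \<subseteq> D"
    show "ennpowr (\<Sum>\<^sub>\<infinity>Q\<in>W. ennpowr (frac_cap \<delta> p (K \<inter> Q) D) (q / p)) (p / q) \<le> ennreal (B powr (p / q)) * frac_cap \<delta> p K D"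
    proof (rule le_mult_frac_cap)
      show "0 < B powr (p / q)" using B by simp
      fix u0 assume u0: "u0 \<in> C0 D" "\<And>x. x \<in> K \<Longrightarrow> 1 \<le> u0 x"
      define u where "u = (\<lambda>x. if x \<in> D then u0 x else 0)"
      have "ennpowr (\<Sum>\<^sub>\<infinity>Q\<in>W. ennpowr (frac_cap \<delta> p (K \<inter> Q) D) r) (p / q) \<le> ennreal (B powr (p / q)) * frac_energy \<delta> p D u"
        using C0_zero_extension[OF u0(1) D(1)] u0(2) K by (intro main) (auto simp: u_def)
      also have "frac_energy \<delta> p D u = frac_energy \<delta> p D u0"
        by (rule frac_energy_cong) (simp add: u_def)
      finally show "ennpowr (\<Sum>\<^sub>\<infinity>Q\<in>W. ennpowr (frac_cap \<delta> p (K \<inter> Q) D) (q / p)) (p / q) \<le> ennreal (B powr (p / q)) * frac_energy \<delta> p D u0"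
        by (simp only: r_def)
    qed
  qed
qed

section \<open>From capacities to the Hardy inequality\<close>

text \<open>For \<open>a = \<bar>K \<inter> Q\<bar>\<close> split \<open>a = a\<^sup>r\<^sup>(\<^sup>1\<^sup>-\<^sup>\<theta>\<^sup>) a\<^sup>\<alpha>\<^sup>/\<^sup>n\<close>.  The last factor is at most a constant times \<open>l\<^sup>\<alpha>\<close> and
  compensates the weight; the first one is controlled by the \<open>r\<close>-th power of the capacity.\<close>

lemma whitney_cube_weight_le_capacity:
  fixes D :: "(real ^ 'n) set"
  assumes D: "open D" "D \<noteq> {}" "D \<noteq> UNIV" and W: "whitney_decomposition D W" and Q: "Q \<in> W"
    and pq: "0 < p" "0 < q" and \<alpha>: "\<alpha> = q * (\<delta> + real CARD('n) * (1/q - 1/p))" "0 \<le> \<alpha>" and C: "0 < C"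
    and sob: "\<And>K. compact K \<Longrightarrow> K \<subseteq> D \<Longrightarrow>
       ennreal (measure lborel K powr (1 - \<delta> * p / real CARD('n))) \<le> ennreal C * frac_cap \<delta> p K D"
    and K: "compact K" "K \<subseteq> D"
  shows "(\<integral>\<^sup>+x\<in>K \<inter> Q. ennreal (1 / infdist x (frontier D) powr \<alpha>) \<partial>lborel)
     \<le> ennreal ((9/8) powr \<alpha> * C powr (q / p)) * ennpowr (frac_cap \<delta> p (K \<inter> Q) D) (q / p)"
proof -
  let ?n = "real CARD('n)"
  define r where "r = q / p"
  have r: "r > 0" using pq by (simp add: r_def)
  obtain l where l: "0 < l" and Qc: "compact Q" and QR: "Q \<subseteq> dilate_cube (9/8) Q"
    and Rm: "dilate_cube (9/8) Q \<in> sets borel"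
    and Re: "emeasure lborel (dilate_cube (9/8) Q) = ennreal ((9/8 * l) ^ CARD('n))"
    and far: "\<And>x. x \<in> Q \<Longrightarrow> l \<le> infdist x (frontier D)"
    by (rule whitney_cube[OF D W Q]) blast
  define a where "a = measure lborel (K \<inter> Q)"
  have KQ: "compact (K \<inter> Q)" using K Qc by (simp add: compact_Int)
  then have KQm: "K \<inter> Q \<in> sets borel" by (simp add: borel_compact)
  have ea: "emeasure lborel (K \<inter> Q) = ennreal a"
    unfolding a_def using emeasure_compact_finite[OF KQ] by (simp add: emeasure_eq_ennreal_measure less_top)
  have a0: "0 \<le> a" by (simp add: a_def)
  have "ennreal a \<le> ennreal ((9/8 * l) ^ CARD('n))"
    unfolding ea[symmetric] Re[symmetric] using QR Rm by (intro emeasure_mono) auto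
  then have al: "a \<le> (9/8 * l) powr ?n" using l by (simp add: powr_realpow)
  have "(\<integral>\<^sup>+x\<in>K \<inter> Q. ennreal (1 / infdist x (frontier D) powr \<alpha>) \<partial>lborel) \<le> (\<integral>\<^sup>+x\<in>K \<inter> Q. ennreal (1 / l powr \<alpha>) \<partial>lborel)"
  proof (intro nn_integral_mono)
    fix x
    show "ennreal (1 / infdist x (frontier D) powr \<alpha>) * indicator (K \<inter> Q) x \<le> ennreal (1 / l powr \<alpha>) * indicator (K \<inter> Q) x"
    proof (cases "x \<in> K \<inter> Q")
      case True
      then have "l powr \<alpha> \<le> infdist x (frontier D) powr \<alpha>"
        using far l \<alpha>(2) by (intro powr_mono2) auto
      moreover have "0 < l powr \<alpha>" using l by simp
      ultimately show ?thesis
        by (intro mult_right_mono ennreal_leI divide_left_mono mult_pos_pos) auto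
    qed simp
  qed
  also have "\<dots> = ennreal (1 / l powr \<alpha> * a)"
    using KQm a0 by (simp add: nn_integral_cmult_indicator ea ennreal_mult del: times_divide_eq_left)
  also have "\<dots> \<le> ennreal ((9/8) powr \<alpha> * (a powr (1 - \<delta> * p / ?n)) powr r)"
  proof (intro ennreal_leI)
    show "1 / l powr \<alpha> * a \<le> (9/8) powr \<alpha> * (a powr (1 - \<delta> * p / ?n)) powr r"
    proof (cases "a = 0")
      case False
      have "(1 - \<delta> * p / ?n) * r + \<alpha> / ?n = 1"
        using pq by (simp add: \<alpha>(1) r_def field_simps)
      then have "a = (a powr (1 - \<delta> * p / ?n)) powr r * a powr (\<alpha> / ?n)"
        using False a0 by (simp add: powr_powr flip: powr_add)
      moreover have "a powr (\<alpha> / ?n) \<le> ((9/8 * l) powr ?n) powr (\<alpha> / ?n)"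
        using al a0 \<alpha>(2) by (intro powr_mono2) auto
      moreover have "((9/8 * l) powr ?n) powr (\<alpha> / ?n) = (9/8) powr \<alpha> * l powr \<alpha>"
        using l unfolding powr_powr by (simp only: powr_mult) simp
      ultimately have "a \<le> (a powr (1 - \<delta> * p / ?n)) powr r * ((9/8) powr \<alpha> * l powr \<alpha>)"
        by (metis mult_left_mono powr_ge_zero)
      then show ?thesis using l by (simp add: field_simps)
    qed simp
  qed
  also have "\<dots> = ennreal ((9/8) powr \<alpha>) * ennpowr (ennreal (a powr (1 - \<delta> * p / ?n))) r"
    by (simp add: ennreal_mult ennpowr_ennreal)
  also have "\<dots> \<le> ennreal ((9/8) powr \<alpha>) * ennpowr (ennreal C * frac_cap \<delta> p (K \<inter> Q) D) r"
    unfolding a_def using KQ K r by (intro mult_left_mono ennpowr_mono sob) auto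
  also have "\<dots> = ennreal ((9/8) powr \<alpha> * C powr r) * ennpowr (frac_cap \<delta> p (K \<inter> Q) D) r"
    using C r by (simp add: ennpowr_mult ennpowr_ennreal ennreal_mult mult.assoc)
  finally show ?thesis by (simp only: r_def)
qed

lemma hardy_from_capacity_sum:
  fixes D :: "(real ^ 'n) set"
  assumes D: "open D" "D \<noteq> {}" "D \<noteq> UNIV" and W: "whitney_decomposition D W"
    and pq: "1 \<le> p" "p \<le> q"
    and \<alpha>: "0 \<le> q * (\<delta> + real CARD('n) * (1/q - 1/p))" and C: "0 < C"
    and sob: "\<And>K. compact K \<Longrightarrow> K \<subseteq> D \<Longrightarrow>
       ennreal (measure lborel K powr (1 - \<delta> * p / real CARD('n))) \<le> ennreal C * frac_cap \<delta> p K D"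
    and N: "0 < N"
    and cap: "\<And>K. compact K \<Longrightarrow> K \<subseteq> D \<Longrightarrow>
        ennpowr (\<Sum>\<^sub>\<infinity>Q\<in>W. ennpowr (frac_cap \<delta> p (K \<inter> Q) D) (q / p)) (p / q) \<le> ennreal N * frac_cap \<delta> p K D"
  shows "frac_hardy \<delta> q p D"
proof -
  define \<alpha> where "\<alpha> = q * (\<delta> + real CARD('n) * (1/q - 1/p))"
  define w where "w = (\<lambda>x. ennreal (1 / infdist x (frontier D) powr \<alpha>))"
  define c where "c = (9/8) powr \<alpha> * C powr (q / p)"
  define H where "H = c * N powr (q / p) * 2 powr (2 * q)"
  have c: "c > 0" using C by (simp add: c_def)
  have H: "H > 0" using c N by (simp add: H_def)
  have [measurable]: "(\<lambda>x. infdist x (frontier D)) \<in> borel_measurable borel"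
    by (intro borel_measurable_continuous_onI continuous_intros)
  have [measurable]: "w \<in> borel_measurable borel" unfolding w_def by measurable
  have local: "(\<integral>\<^sup>+x\<in>K \<inter> Q. w x \<partial>lborel) \<le> ennreal c * ennpowr (frac_cap \<delta> p (K \<inter> Q) D) (q / p)"
    if "compact K" "K \<subseteq> D" "Q \<in> W" for K Q
    unfolding w_def c_def using that pq \<alpha>
    by (intro whitney_cube_weight_le_capacity[OF D W _ _ _ \<alpha>_def _ C sob]) (auto simp: \<alpha>_def)
  have "(\<integral>\<^sup>+x\<in>D. ennreal (\<bar>u0 x\<bar> powr q / infdist x (frontier D) powr \<alpha>) \<partial>lborel)
      \<le> ennreal H * ennpowr (frac_energy \<delta> p D u0) (q / p)" if u0: "u0 \<in> C0 D" for u0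
  proof -
    \<comment> \<open>The extension by zero is measurable and changes neither side.\<close>
    define u where "u = (\<lambda>x. if x \<in> D then u0 x else 0)"
    have u: "u \<in> C0 D" "u \<in> borel_measurable borel"
      using C0_zero_extension[OF u0 D(1)] by (simp_all add: u_def)
    have Q: "Q \<in> sets borel" if "Q \<in> W" for Q
      using that by (rule whitney_cube[OF D W]) (simp add: borel_compact)
    have "(\<integral>\<^sup>+x\<in>D. ennreal (\<bar>u0 x\<bar> powr q / infdist x (frontier D) powr \<alpha>) \<partial>lborel)
        = (\<integral>\<^sup>+x\<in>D. ennreal (\<bar>u x\<bar> powr q) * w x \<partial>lborel)"
      by (intro nn_integral_cong) (auto simp: u_def w_def indicator_def simp flip: ennreal_mult)
    also have "\<dots> \<le> ennreal (c * N powr (q / p) * 2 powr (2 * q)) * ennpowr (frac_energy \<delta> p D u) (q / p)"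
    proof (rule weighted_inequality_from_capacity[where W = W])
      show "countable W" using W by (rule whitney_countable)
      show "\<Union>W = D" using W by (simp add: whitney_decomposition_def)
    qed (use D Q pq c N local cap u in auto)
    also have "frac_energy \<delta> p D u = frac_energy \<delta> p D u0"
      by (rule frac_energy_cong) (simp add: u_def)
    finally show ?thesis by (simp only: H_def)
  qed
  then show ?thesis
    unfolding frac_hardy_def using H by (intro exI[of _ H]) (simp add: \<alpha>_def)
qed

section \<open>Equivalence\<close>

theorem theorem6p1:
  fixes D :: "(real ^ 'n) set" and W :: "(real ^ 'n) set set"
    and c \<delta> p q :: real
  assumes "2 \<le> CARD('n)"
    and "1 \<le> c"
    and "john_domain c D" and "\<not> bounded D" and "D \<noteq> UNIV"
    and "whitney_decomposition D W"
    and "0 < \<delta>" and "\<delta> < 1"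
    and "1 \<le> p" and "1 \<le> q"
    and "p < real CARD('n) / \<delta>"
    and "0 \<le> 1/p - 1/q" and "1/p - 1/q \<le> \<delta> / real CARD('n)"
  shows "frac_hardy \<delta> q p D \<longleftrightarrow>
    (\<exists>N::real. N > 0 \<and> (\<forall>K. compact K \<and> K \<subseteq> D \<longrightarrow>
       ennpowr (\<Sum>\<^sub>\<infinity>Q\<in>W. ennpowr (frac_cap \<delta> p (K \<inter> Q) D) (q / p)) (p / q)
         \<le> ennreal N * frac_cap \<delta> p K D))"
proof -
  have D: "open D" "D \<noteq> {}" "D \<noteq> UNIV"
    using assms by (auto simp: john_domain_def)
  have pq: "p \<le> q"
    using \<open>0 \<le> 1/p - 1/q\<close> \<open>1 \<le> p\<close> \<open>1 \<le> q\<close> by (simp add: field_simps)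
  have \<alpha>: "0 \<le> q * (\<delta> + real CARD('n) * (1/q - 1/p))"
  proof (rule mult_nonneg_nonneg)
    have "real CARD('n) * (1/p - 1/q) \<le> \<delta>"
      using \<open>1/p - 1/q \<le> \<delta> / real CARD('n)\<close> by (simp add: field_simps)
    then show "0 \<le> \<delta> + real CARD('n) * (1/q - 1/p)" by (simp add: algebra_simps)
  qed (use \<open>1 \<le> q\<close> in simp)
  show ?thesis
  proof
    assume "frac_hardy \<delta> q p D"
    then show "\<exists>N::real. N > 0 \<and> (\<forall>K. compact K \<and> K \<subseteq> D \<longrightarrow>
       ennpowr (\<Sum>\<^sub>\<infinity>Q\<in>W. ennpowr (frac_cap \<delta> p (K \<inter> Q) D) (q / p)) (p / q) \<le> ennreal N * frac_cap \<delta> p K D)"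
      by (rule capacity_sum_from_hardy[OF D \<open>whitney_decomposition D W\<close> \<open>0 < \<delta>\<close> \<open>\<delta> < 1\<close> \<open>1 \<le> p\<close> pq \<alpha>]) blast
  next
    assume "\<exists>N::real. N > 0 \<and> (\<forall>K. compact K \<and> K \<subseteq> D \<longrightarrow>
       ennpowr (\<Sum>\<^sub>\<infinity>Q\<in>W. ennpowr (frac_cap \<delta> p (K \<inter> Q) D) (q / p)) (p / q) \<le> ennreal N * frac_cap \<delta> p K D)"
    then obtain N where N: "0 < N" "\<And>K. compact K \<Longrightarrow> K \<subseteq> D \<Longrightarrow>
       ennpowr (\<Sum>\<^sub>\<infinity>Q\<in>W. ennpowr (frac_cap \<delta> p (K \<inter> Q) D) (q / p)) (p / q) \<le> ennreal N * frac_cap \<delta> p K D"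
      by blast
    obtain \<kappa> where \<kappa>: "0 < \<kappa>"
      "\<And>x r. x \<in> D \<Longrightarrow> 0 < r \<Longrightarrow> ennreal (\<kappa> * r ^ CARD('n)) \<le> emeasure lborel (D \<inter> ball x r)"
      using john_domain_measure_density[OF \<open>john_domain c D\<close> \<open>1 \<le> c\<close> \<open>\<not> bounded D\<close>] by blast
    have p: "0 < p" using \<open>1 \<le> p\<close> by simp
    obtain C where C: "0 < C" "\<And>K. compact K \<Longrightarrow> K \<subseteq> D \<Longrightarrow>
       ennreal (measure lborel K powr (1 - \<delta> * p / real CARD('n))) \<le> ennreal C * frac_cap \<delta> p K D"
      using weak_fractional_sobolev[OF D(1) \<kappa> p \<open>0 < \<delta>\<close> \<open>p < real CARD('n) / \<delta>\<close>] by blast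
    show "frac_hardy \<delta> q p D"
      by (rule hardy_from_capacity_sum[OF D \<open>whitney_decomposition D W\<close> \<open>1 \<le> p\<close> pq \<alpha> C N])
  qed
qed

end
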